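(* Let $k$ be a perfect field, let $A,B$ be abelian varieties over $k$ and let $\varphi:A\to B$ be an isogeny. Let $\varphi_\star:\mathrm{CH}_0(A)\to\mathrm{CH}_0(B)$ be the induced proper push-forward. Then $\varphi_\star(F^r(A))\subset F^r(B)$ for all $r\geq 0$.
   Context: **Somekawa $K$-group.** Let $A_1,\ldots,A_r$ be abelian varieties over $k$. For finite extensions $K\subset L$ of $k$ there are restriction maps $\mathrm{res}_{L/K}:A_i(K)\to A_i(L)$ and norm (trace) maps $N_{L/K}:A_i(L)\to A_i(K)$. The Mackey product $(A_1\otimes^M\cdots\otimes^M A_r)(k)$ is the quotient of $\bigoplus_{L/k\text{ finite}}A_1(L)\otimes_{\mathbb Z}\cdots\otimes_{\mathbb Z} A_r(L)$ by the projection formula relations; writing $\{a_1,\ldots,a_r\}_{L/k}$ for the class of $a_1\otimes\cdots\otimes a_r$ with $a_i\in A_i(L)$, these are: for every tower of finite extensions $k\subset K\subset L$ (with $K\to L$ any $k$-embedding), every $i$, every $a_i\in A_i(L)$ and $a_j\in A_j(K)$ for $j\neq i$, $\{\mathrm{res}_{L/K}(a_1),\ldots,a_i,\ldots,\mathrm{res}_{L/K}(a_r)\}_{L/k}=\{a_1,\ldots,N_{L/K}(a_i),\ldots,a_r\}_{K/k}$. The Somekawa $K$-group $K(k;A_1,\ldots,A_r)$ is the quotient of the Mackey product by Weil reciprocity: for every smooth projective curve $C$ over $k$, all regular maps $g_i:C\to A_i$ ($i=1,\ldots,r$) and every $f\in k(C)^\times$, $\sum_{x}\mathrm{ord}_x(f)\{g_1\circ\iota_x,\ldots,g_r\circ\iota_x\}_{k(x)/k}=0$,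 the sum being over closed points $x$ of $C$, with $\iota_x:\mathrm{Spec}\,k(x)\to C$ the canonical inclusion. **Symmetric quotient.** For an abelian variety $A$ and $r\geq 1$, $K_r(k;A)=K(k;A,\ldots,A)$ ($r$ copies) and $S_r(k;A)$ is the quotient of $K_r(k;A)$ by the action of the symmetric group $\Sigma_r$ permuting entries of symbols. Set $K_0(k;A)=S_0(k;A)=\mathbb Z$. **The filtration $F^r(A)$.** For every $r\geq 0$ there is a well-defined homomorphism $\Phi_r:\mathrm{CH}_0(A)\to S_r(k;A)$ sending the class $[a]$ of a closed point $a$ with residue field $k(a)$ to $\{a,\ldots,a\}_{k(a)/k}$ (for $r=0$ it is the degree map). Set $F^0(A)=\mathrm{CH}_0(A)$ and $F^r(A)=\bigcap_{j=0}^{r-1}\ker(\Phi_j)$ for $r\geq 1$. *)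

theory Defs
  imports
    "HOL-Algebra.Algebraic_Closure_Type"
    "HOL-Algebra.Generated_Fields"
    "HOL-Algebra.Generated_Groups"
    "HOL-Algebra.Free_Abelian_Groups"
    "HOL-Combinatorics.Permutations"
    "HOL-Library.Extended_Nat"
begin

text \<open>
  Projective varieties over a perfect field k are treated classically: the field is a type
  \<open>'k\<close>, its algebraic closure is \<open>'k alg_closure\<close>, and a (reduced) projective
  k-scheme is represented by its set of geometric points, that is, by the zero set in projective
  space over the algebraic closure of homogeneous polynomials with coefficients in k.  Its closed
  points are the Galois orbits of geometric points.
\<close>

section \<open>Fields\<close>

definition perfect_field :: "'k::field itself \<Rightarrow> bool" where
  "perfect_field _ \<longleftrightarrow>
     (\<forall>p :: 'k poly. Factorial_Ring.irreducible p \<longrightarrow> rsquarefree (map_poly to_ac p))"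

abbreviation kbar :: "'k::field alg_closure ring" where
  "kbar \<equiv> ring_of_type_algebra"

definition base_field :: "'k::field alg_closure set" where
  "base_field = range to_ac"

text \<open>
  Every finite extension of k is isomorphic to one inside the algebraic closure, so only those
  are used; all k-embeddings between them are kept in the relations below.
\<close>

definition finite_ext :: "'k::field alg_closure set \<Rightarrow> bool" where
  "finite_ext L \<longleftrightarrow> subfield L kbar \<and> base_field \<subseteq> L \<and> ring.finite_dimension kbar base_field L"

definition ext_degree :: "'k::field alg_closure set \<Rightarrow> 'k alg_closure set \<Rightarrow> nat" where
  "ext_degree K L = ring.dim kbar K L"

definition embeddings ::
  "'k::field alg_closure set \<Rightarrow> 'k alg_closure set \<Rightarrow> ('k alg_closure \<Rightarrow> 'k alg_closure) set" where
  "embeddings K L =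
     {\<tau> \<in> extensional K. \<tau> \<in> ring_hom (kbar\<lparr>carrier := K\<rparr>) (kbar\<lparr>carrier := L\<rparr>) \<and>
        (\<forall>c\<in>base_field. \<tau> c = c)}"

definition galois_group :: "('k::field alg_closure \<Rightarrow> 'k alg_closure) set" where
  "galois_group = {\<sigma> \<in> ring_iso kbar kbar. \<forall>c\<in>base_field. \<sigma> c = c}"

section \<open>Projective varieties\<close>

text \<open>
  A point of n-dimensional projective space is represented by its unique vector of homogeneous
  coordinates whose first nonzero entry is 1; the coordinates of index greater than n are 0.
  With this normalisation a point is defined over a field L iff all its coordinates lie in L, and
  the Galois group acts coordinatewise.
\<close>

type_synonym 'k point = "nat \<Rightarrow> 'k alg_closure"

definition proj_space :: "nat \<Rightarrow> 'k::field point set" where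
  "proj_space n = {P. (\<exists>i\<le>n. P i = 1 \<and> (\<forall>j<i. P j = 0)) \<and> (\<forall>i>n. P i = 0)}"

definition normalise :: "'k::field point \<Rightarrow> 'k point" where
  "normalise v = (\<lambda>i. v i / v (LEAST j. v j \<noteq> 0))"

text \<open>
  Homogeneous polynomials of degree d in the variables 0, ..., n with coefficients in K, as
  functions; an algebraically closed field is infinite, so this loses nothing.
\<close>

inductive form :: "'k::field alg_closure set \<Rightarrow> nat \<Rightarrow> nat \<Rightarrow> ('k point \<Rightarrow> 'k alg_closure) \<Rightarrow> bool"
  for K n where
  const: "c \<in> K \<Longrightarrow> form K n 0 (\<lambda>_. c)"
| coord: "i \<le> n \<Longrightarrow> form K n 1 (\<lambda>v. v i)"
| add: "form K n d F \<Longrightarrow> form K n d G \<Longrightarrow> form K n d (\<lambda>v. F v + G v)"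
| mult: "form K n d F \<Longrightarrow> form K n e G \<Longrightarrow> form K n (d + e) (\<lambda>v. F v * G v)"

definition zariski_closed :: "'k::field alg_closure set \<Rightarrow> nat \<Rightarrow> 'k point set \<Rightarrow> bool" where
  "zariski_closed K n V \<longleftrightarrow>
     (\<exists>S \<subseteq> {F. \<exists>d. form K n d F}. V = {P \<in> proj_space n. \<forall>F\<in>S. F P = 0})"

definition irreducible_closed :: "'k::field alg_closure set \<Rightarrow> nat \<Rightarrow> 'k point set \<Rightarrow> bool" where
  "irreducible_closed K n V \<longleftrightarrow> zariski_closed K n V \<and> V \<noteq> {} \<and>
     (\<forall>U W. zariski_closed K n U \<and> zariski_closed K n W \<and> V = U \<union> W \<longrightarrow> V = U \<or> V = W)"

definition krull_dim :: "'k::field alg_closure set \<Rightarrow> nat \<Rightarrow> 'k point set \<Rightarrow> enat" where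
  "krull_dim K n V =
     (SUP d \<in> {d. \<exists>Z. (\<forall>i\<le>d. irreducible_closed K n (Z i) \<and> Z i \<subseteq> V) \<and>
                       (\<forall>i<d. Z i \<subset> Z (Suc i))}. enat d)"

text \<open>
  Regular maps defined over K from V in projective n-space to W in projective m-space: locally
  given by forms of equal degree.  The function is unconstrained outside V.
\<close>

definition regular_map ::
  "'k::field alg_closure set \<Rightarrow> nat \<Rightarrow> 'k point set \<Rightarrow> nat \<Rightarrow> 'k point set \<Rightarrow> ('k point \<Rightarrow> 'k point) \<Rightarrow> bool"
where
  "regular_map K n V m W f \<longleftrightarrow> f ` V \<subseteq> W \<and>
     (\<forall>P\<in>V. \<exists>d F. (\<forall>i\<le>m. form K n d (F i)) \<and> (\<exists>i\<le>m. F i P \<noteq> 0) \<and>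
        (\<forall>Q\<in>V. (\<exists>i\<le>m. F i Q \<noteq> 0) \<longrightarrow> f Q = normalise (\<lambda>i. if i \<le> m then F i Q else 0)))"

text \<open>The Segre embedding; it preserves the normalisation of points.\<close>

definition segre :: "nat \<Rightarrow> nat \<Rightarrow> 'k::field point \<Rightarrow> 'k point \<Rightarrow> 'k point" where
  "segre n m P Q =
     (\<lambda>l. if l < (n + 1) * (m + 1) then P (l div (m + 1)) * Q (l mod (m + 1)) else 0)"

section \<open>Closed points and zero-cycles\<close>

definition closed_points :: "'k::field point set \<Rightarrow> 'k point set set" where
  "closed_points V = (\<lambda>P. (\<lambda>\<sigma>. \<sigma> \<circ> P) ` galois_group) ` V"

definition geom_point :: "'k::field point set \<Rightarrow> 'k point" where
  "geom_point x = (SOME P. P \<in> x)"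

text \<open>The residue field at a geometric point is generated by the ratios of its coordinates.\<close>

definition residue_field :: "'k::field point \<Rightarrow> 'k alg_closure set" where
  "residue_field P = generate_field kbar (base_field \<union> range P)"

abbreviation zero_cycles :: "'k::field point set \<Rightarrow> ('k point set \<Rightarrow>\<^sub>0 int) monoid" where
  "zero_cycles V \<equiv> free_Abelian_group (closed_points V)"

text \<open>\<open>f_*[x] = [k(x) : k(f(x))] [f(x)]\<close>\<close>

definition cycle_push ::
  "('k::field point \<Rightarrow> 'k point) \<Rightarrow> ('k point set \<Rightarrow>\<^sub>0 int) \<Rightarrow> ('k point set \<Rightarrow>\<^sub>0 int)" where
  "cycle_push f = frag_extend (\<lambda>x.
     frag_cmul (int (ext_degree (residue_field (f (geom_point x))) (residue_field (geom_point x))))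
       (frag_of (f ` x)))"

definition cycle_degree :: "('k::field point set \<Rightarrow>\<^sub>0 int) \<Rightarrow> int" where
  "cycle_degree z =
     (\<Sum>x \<in> Poly_Mapping.keys z. Poly_Mapping.lookup z x *
        int (ext_degree base_field (residue_field (geom_point x))))"

section \<open>Smooth projective curves and divisors of rational functions\<close>

text \<open>
  Fractions \<open>F / G\<close> of forms of equal degree over K with \<open>G(P) \<noteq> 0\<close>, compared as
  functions on V, make up the local ring of V at P.  A form F of degree e lies in the d-th power
  of the maximal ideal (after division by the e-th power of a coordinate not vanishing at P) iff,
  up to a form not vanishing at P, it agrees on V with an element of the d-th power of the
  homogeneous ideal of P.
\<close>

inductive vanishing_power ::
  "'k::field alg_closure set \<Rightarrow> nat \<Rightarrow> 'k point \<Rightarrow> nat \<Rightarrow> nat \<Rightarrow> ('k point \<Rightarrow> 'k alg_closure) \<Rightarrow> bool"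
  for K n P where
  zero: "form K n e G \<Longrightarrow> vanishing_power K n P 0 e G"
| Suc: "vanishing_power K n P d e G \<Longrightarrow> form K n e' F \<Longrightarrow> F P = 0 \<Longrightarrow>
    vanishing_power K n P (Suc d) (e + e') (\<lambda>v. G v * F v)"
| add: "vanishing_power K n P d e G \<Longrightarrow> vanishing_power K n P d e G' \<Longrightarrow>
    vanishing_power K n P d e (\<lambda>v. G v + G' v)"

definition in_max_ideal_power ::
  "'k::field alg_closure set \<Rightarrow> nat \<Rightarrow> 'k point set \<Rightarrow> 'k point \<Rightarrow> nat \<Rightarrow> nat \<Rightarrow>
   ('k point \<Rightarrow> 'k alg_closure) \<Rightarrow> bool" where
  "in_max_ideal_power K n V P d e F \<longleftrightarrow>
     (\<exists>h H G. form K n h H \<and> H P \<noteq> 0 \<and> vanishing_power K n P d (h + e) G \<and>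
        (\<forall>Q\<in>V. H Q * F Q = G Q))"

definition max_ideal_principal ::
  "'k::field alg_closure set \<Rightarrow> nat \<Rightarrow> 'k point set \<Rightarrow> 'k point \<Rightarrow> bool" where
  "max_ideal_principal K n V P \<longleftrightarrow>
     (\<exists>t T. form K n t T \<and> T P = 0 \<and>
        (\<forall>e F. form K n e F \<and> F P = 0 \<longrightarrow>
           (\<exists>h H g G. form K n h H \<and> H P \<noteq> 0 \<and> form K n g G \<and> h + e = t + g \<and>
              (\<forall>Q\<in>V. H Q * F Q = T Q * G Q))))"

text \<open>
  Smoothness over k is regularity of the local rings at all geometric points, computed over the
  algebraic closure; in dimension one this means that the maximal ideal is generated by one
  element.  Curves are irreducible over k but need not be geometrically irreducible.
\<close>

definition smooth_projective_curve :: "nat \<Rightarrow> 'k::field point set \<Rightarrow> bool" where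
  "smooth_projective_curve n C \<longleftrightarrow>
     irreducible_closed base_field n C \<and> krull_dim base_field n C = 1 \<and>
     (\<forall>P\<in>C. max_ideal_principal UNIV n C P)"

text \<open>\<open>F / G\<close> is a nonzero element of the function field \<open>k(C)\<close>.\<close>

definition nonzero_function ::
  "nat \<Rightarrow> 'k::field point set \<Rightarrow> nat \<Rightarrow> ('k point \<Rightarrow> 'k alg_closure) \<Rightarrow> ('k point \<Rightarrow> 'k alg_closure) \<Rightarrow> bool"
where
  "nonzero_function n C e F G \<longleftrightarrow> form base_field n e F \<and> form base_field n e G \<and>
     (\<exists>P\<in>C. F P \<noteq> 0) \<and> (\<exists>P\<in>C. G P \<noteq> 0)"

definition form_order ::
  "nat \<Rightarrow> 'k::field point set \<Rightarrow> 'k point \<Rightarrow> nat \<Rightarrow> ('k point \<Rightarrow> 'k alg_closure) \<Rightarrow> nat" where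
  "form_order n C P e F = (GREATEST d. in_max_ideal_power base_field n C P d e F)"

definition ord_at ::
  "nat \<Rightarrow> 'k::field point set \<Rightarrow> nat \<Rightarrow> ('k point \<Rightarrow> 'k alg_closure) \<Rightarrow> ('k point \<Rightarrow> 'k alg_closure) \<Rightarrow>
   'k point set \<Rightarrow> int" where
  "ord_at n C e F G x =
     int (form_order n C (geom_point x) e F) - int (form_order n C (geom_point x) e G)"

definition principal_divisor ::
  "nat \<Rightarrow> 'k::field point set \<Rightarrow> nat \<Rightarrow> ('k point \<Rightarrow> 'k alg_closure) \<Rightarrow> ('k point \<Rightarrow> 'k alg_closure) \<Rightarrow>
   ('k point set \<Rightarrow>\<^sub>0 int)" where
  "principal_divisor n C e F G =
     (\<Sum>x \<in> {x \<in> closed_points C. ord_at n C e F G x \<noteq> 0}. frag_cmul (ord_at n C e F G x) (frag_of x))"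

section \<open>The Chow group of zero-cycles\<close>

text \<open>
  Rational equivalence is generated by the push-forwards \<open>g_* div(f)\<close> along morphisms
  \<open>g : C \<rightarrow> V\<close> from smooth projective curves, where \<open>f \<in> k(C)\<^sup>\<times>\<close>;
  since k is perfect, normalisations of curves in V are smooth.
\<close>

definition rat_equiv :: "nat \<Rightarrow> 'k::field point set \<Rightarrow> ('k point set \<Rightarrow>\<^sub>0 int) set" where
  "rat_equiv m V = generate (zero_cycles V)
     {cycle_push g (principal_divisor n C e F G) | n C g e F G.
        smooth_projective_curve n C \<and> regular_map base_field n C m V g \<and>
        nonzero_function n C e F G}"

definition CH0 :: "nat \<Rightarrow> 'k::field point set \<Rightarrow> ('k point set \<Rightarrow>\<^sub>0 int) set monoid" where
  "CH0 m V = zero_cycles V Mod rat_equiv m V"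

definition CH0_push ::
  "nat \<Rightarrow> 'k::field point set \<Rightarrow> ('k point \<Rightarrow> 'k point) \<Rightarrow>
   ('k point set \<Rightarrow>\<^sub>0 int) set \<Rightarrow> ('k point set \<Rightarrow>\<^sub>0 int) set" where
  "CH0_push m W f c =
     the_elem ((\<lambda>z. rat_equiv m W #>\<^bsub>zero_cycles W\<^esub> cycle_push f z) ` c)"

section \<open>Abelian varieties\<close>

text \<open>
  A record holds the set of geometric points, the group law on it (written multiplicatively, as
  always in HOL-Algebra) and the dimension of the ambient projective space.
\<close>

record 'a proj_group = "(nat \<Rightarrow> 'a) monoid" +
  ambient :: nat

text \<open>
  Projectivity and commutativity are theorems for complete geometrically irreducible group
  varieties, so building them in excludes nothing; smoothness follows by homogeneity.  The
  product variety is taken in its Segre embedding.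
\<close>

definition abelian_variety :: "'k::field alg_closure proj_group \<Rightarrow> bool" where
  "abelian_variety A \<longleftrightarrow>
     comm_group A \<and>
     zariski_closed base_field (ambient A) (carrier A) \<and>
     irreducible_closed UNIV (ambient A) (carrier A) \<and>
     range \<one>\<^bsub>A\<^esub> \<subseteq> base_field \<and>
     regular_map base_field (ambient A) (carrier A) (ambient A) (carrier A) (\<lambda>P. inv\<^bsub>A\<^esub> P) \<and>
     (\<exists>\<mu>. regular_map base_field ((ambient A + 1) * (ambient A + 1) - 1)
              {segre (ambient A) (ambient A) P Q | P Q. P \<in> carrier A \<and> Q \<in> carrier A}
              (ambient A) (carrier A) \<mu> \<and>
          (\<forall>P\<in>carrier A. \<forall>Q\<in>carrier A. \<mu> (segre (ambient A) (ambient A) P Q) = P \<otimes>\<^bsub>A\<^esub> Q))"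

definition isogeny ::
  "'k::field alg_closure proj_group \<Rightarrow> 'k alg_closure proj_group \<Rightarrow> ('k point \<Rightarrow> 'k point) \<Rightarrow> bool" where
  "isogeny A B \<phi> \<longleftrightarrow>
     regular_map base_field (ambient A) (carrier A) (ambient B) (carrier B) \<phi> \<and>
     \<phi> \<in> hom A B \<and> \<phi> ` carrier A = carrier B \<and> finite (kernel A B \<phi>)"

definition rational_points ::
  "'k::field alg_closure proj_group \<Rightarrow> 'k alg_closure set \<Rightarrow> 'k point set" where
  "rational_points A L = {P \<in> carrier A. range P \<subseteq> L}"

text \<open>
  For a k-embedding \<open>\<tau> : K \<rightarrow> L\<close>, restriction \<open>A(K) \<rightarrow> A(L)\<close> is
  \<open>a \<mapsto> \<tau> \<circ> a\<close>, and the norm \<open>A(L) \<rightarrow> A(K)\<close> is the sum over all embeddings of L into the algebraic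
  closure that are K-linear when L is a K-algebra via \<open>\<tau>\<close> (L/K is separable).
\<close>

definition norm_map ::
  "'k::field alg_closure proj_group \<Rightarrow> ('k alg_closure \<Rightarrow> 'k alg_closure) \<Rightarrow>
   'k alg_closure set \<Rightarrow> 'k alg_closure set \<Rightarrow> 'k point \<Rightarrow> 'k point" where
  "norm_map A \<tau> K L a =
     finprod A (\<lambda>s. s \<circ> a) {s \<in> embeddings L UNIV. \<forall>c\<in>K. s (\<tau> c) = c}"

section \<open>Somekawa K-groups\<close>

text \<open>
  \<open>(L, as)\<close> stands for the symbol \<open>{a_1, ..., a_r}_{L/k}\<close>.  The direct sum of
  tensor products is presented by these symbols and the multilinearity relations.
\<close>

type_synonym 'k symbol = "'k alg_closure set \<times> 'k point list"

definition symbols :: "'k::field alg_closure proj_group list \<Rightarrow> 'k symbol set" where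
  "symbols As = {(L, as). finite_ext L \<and> list_all2 (\<lambda>a A. a \<in> rational_points A L) as As}"

definition multilinear_relations :: "'k::field alg_closure proj_group list \<Rightarrow> ('k symbol \<Rightarrow>\<^sub>0 int) set" where
  "multilinear_relations As =
     {frag_of (L, as[i := a \<otimes>\<^bsub>As ! i\<^esub> b]) - frag_of (L, as[i := a]) - frag_of (L, as[i := b])
        | L as i a b. (L, as) \<in> symbols As \<and> i < length As \<and>
            a \<in> rational_points (As ! i) L \<and> b \<in> rational_points (As ! i) L}"

definition projection_relations :: "'k::field alg_closure proj_group list \<Rightarrow> ('k symbol \<Rightarrow>\<^sub>0 int) set" where
  "projection_relations As =
     {frag_of (L, (map (\<lambda>b. \<tau> \<circ> b) as)[i := a]) - frag_of (K, as[i := norm_map (As ! i) \<tau> K L a])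
        | K L \<tau> as i a. finite_ext K \<and> finite_ext L \<and> \<tau> \<in> embeddings K L \<and>
            (K, as) \<in> symbols As \<and> i < length As \<and> a \<in> rational_points (As ! i) L}"

definition weil_relations :: "'k::field alg_closure proj_group list \<Rightarrow> ('k symbol \<Rightarrow>\<^sub>0 int) set" where
  "weil_relations As =
     {frag_extend
        (\<lambda>x. frag_of (residue_field (geom_point x), map (\<lambda>g. g (geom_point x)) gs))
        (principal_divisor n C e F G)
        | n C gs e F G. smooth_projective_curve n C \<and> nonzero_function n C e F G \<and>
            list_all2 (\<lambda>g A. regular_map base_field n C (ambient A) (carrier A) g) gs As}"

definition somekawa_relations :: "'k::field alg_closure proj_group list \<Rightarrow> ('k symbol \<Rightarrow>\<^sub>0 int) set" where
  "somekawa_relations As = multilinear_relations As \<union> projection_relations As \<union> weil_relations As"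

definition somekawa_K :: "'k::field alg_closure proj_group list \<Rightarrow> ('k symbol \<Rightarrow>\<^sub>0 int) set monoid" where
  "somekawa_K As = free_Abelian_group (symbols As) Mod
     generate (free_Abelian_group (symbols As)) (somekawa_relations As)"

text \<open>
  \<open>S_r(k; A)\<close>, for r at least 1, is the quotient of \<open>somekawa_K (replicate r A)\<close> by the relations identifying
  symbols with permuted entries, here presented by generators and relations in one step.
\<close>

definition permutation_relations ::
  "nat \<Rightarrow> 'k::field alg_closure proj_group \<Rightarrow> ('k symbol \<Rightarrow>\<^sub>0 int) set" where
  "permutation_relations r A =
     {frag_of (L, permute_list p as) - frag_of (L, as)
        | L as p. (L, as) \<in> symbols (replicate r A) \<and> p permutes {..<r}}"

definition symmetric_relations ::
  "nat \<Rightarrow> 'k::field alg_closure proj_group \<Rightarrow> ('k symbol \<Rightarrow>\<^sub>0 int) set" where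
  "symmetric_relations r A = generate (free_Abelian_group (symbols (replicate r A)))
     (somekawa_relations (replicate r A) \<union> permutation_relations r A)"

definition symmetric_K :: "nat \<Rightarrow> 'k::field alg_closure proj_group \<Rightarrow> ('k symbol \<Rightarrow>\<^sub>0 int) set monoid" where
  "symmetric_K r A = free_Abelian_group (symbols (replicate r A)) Mod symmetric_relations r A"

section \<open>The filtration on the Chow group of zero-cycles\<close>

abbreviation CH :: "'k::field alg_closure proj_group \<Rightarrow> ('k point set \<Rightarrow>\<^sub>0 int) set monoid" where
  "CH A \<equiv> CH0 (ambient A) (carrier A)"

definition Phi0 :: "('k::field point set \<Rightarrow>\<^sub>0 int) set \<Rightarrow> int" where
  "Phi0 c = the_elem (cycle_degree ` c)"

definition Phi ::
  "nat \<Rightarrow> 'k::field alg_closure proj_group \<Rightarrow> ('k point set \<Rightarrow>\<^sub>0 int) set \<Rightarrow> ('k symbol \<Rightarrow>\<^sub>0 int) set" where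
  "Phi r A c = the_elem ((\<lambda>z. symmetric_relations r A #>\<^bsub>free_Abelian_group (symbols (replicate r A))\<^esub>
     frag_extend (\<lambda>x. frag_of (residue_field (geom_point x), replicate r (geom_point x))) z) ` c)"

text \<open>The case distinction is needed because \<open>S_0(k; A)\<close> is the group of integers.\<close>

definition ker_Phi :: "nat \<Rightarrow> 'k::field alg_closure proj_group \<Rightarrow> ('k point set \<Rightarrow>\<^sub>0 int) set set" where
  "ker_Phi r A =
     (if r = 0 then kernel (CH A) integer_group Phi0
      else kernel (CH A) (symmetric_K r A) (Phi r A))"

definition filtration :: "nat \<Rightarrow> 'k::field alg_closure proj_group \<Rightarrow> ('k point set \<Rightarrow>\<^sub>0 int) set set" where
  "filtration r A = carrier (CH A) \<inter> (\<Inter>j<r. ker_Phi j A)"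

end

theory Submission
  imports Defs
begin

text \<open>
  Everything rests on one identity: for a regular map \<open>g : V \<rightarrow> A\<close> and a closed point x of V, the
  projection formula gives \<open>{g x, ..., g x}_{k(x)/k} = [k(x) : k(g x)] {g x, ..., g x}_{k(g x)/k}\<close>,
  because the norm from \<open>k(x)\<close> to \<open>k(g x)\<close> multiplies a point already defined over
  \<open>k(g x)\<close> by the number of embeddings, which is the degree as k is perfect.  Applied to curves over A it
  turns Weil reciprocity into the well-definedness of \<open>\<Phi>\<^sub>r\<close>; applied to the isogeny it says that
  \<open>\<Phi>\<^sub>r\<close> commutes with push-forward, where \<open>S\<^sub>r(k; A) \<rightarrow> S\<^sub>r(k; B)\<close> applies the isogeny to the
  entries of symbols.  In degree zero, push-forward preserves the degree of a cycle.
\<close>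

text \<open>Three obstacles shape the proof. First, \<open>geom_point\<close> picks an arbitrary
  member of a Galois orbit, so the point chosen in the image of x under g is only known to be
  \<sigma> \<circ> g P for some automorphism \<sigma>; the projection formula is therefore applied
  along the embedding induced by the inverse of \<sigma>, not along an inclusion of fields. Second,
  the relations have to be supported on genuine symbols, as otherwise \<open>generate\<close> need
  not yield a subgroup. For the projection relations this says that norms from L to K are
  K-rational, a descent statement. It is obtained by counting: a finite extension has as many
  embeddings as its degree, so an element moved by no embedding generates an extension of degree
  one. Third, \<open>CH0_push\<close>, \<open>Phi\<close> and \<open>Phi0\<close> are defined
  through \<open>the_elem\<close>, so nothing can be said about them before the image of a whole
  coset is known; for \<open>Phi0\<close> the two images are compared as sets of integers.\<close>

lemma field_kbar: "field kbar"
  by (rule field_from_type_algebra)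

interpretation kbar: domain kbar
  using field_kbar by (rule field.axioms)

lemma kbar_simps [simp]:
  "carrier kbar = UNIV"
  "x \<otimes>\<^bsub>kbar\<^esub> y = x * y"
  "x \<oplus>\<^bsub>kbar\<^esub> y = x + y"
  "\<zero>\<^bsub>kbar\<^esub> = 0"
  "\<one>\<^bsub>kbar\<^esub> = 1"
  by (simp_all add: ring_of_type_algebra_def)

lemma kbar_a_inv [simp]: "\<ominus>\<^bsub>kbar\<^esub> x = - x"
  by (rule kbar.minus_equality) auto

lemma kbar_m_inv [simp]: "x \<noteq> 0 \<Longrightarrow> inv\<^bsub>kbar\<^esub> x = inverse x"
  by (rule kbar.inv_char) auto

lemma kbar_nat_pow [simp]: "x [^]\<^bsub>kbar\<^esub> (n::nat) = x ^ n"
  by (induction n) auto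

section \<open>Subfields of the algebraic closure\<close>

lemma subfieldI_kbar:
  assumes "1 \<in> K" "\<And>x y. x \<in> K \<Longrightarrow> y \<in> K \<Longrightarrow> x + y \<in> K" "\<And>x. x \<in> K \<Longrightarrow> - x \<in> K"
    "\<And>x y. x \<in> K \<Longrightarrow> y \<in> K \<Longrightarrow> x * y \<in> K" "\<And>x. x \<in> K \<Longrightarrow> x \<noteq> 0 \<Longrightarrow> inverse x \<in> K"
  shows "subfield K kbar"
  by (rule field.subfieldI'[OF field_kbar], rule kbar.subringI) (use assms in auto)

context
  fixes K :: "'k::field alg_closure set"
  assumes K: "subfield K kbar"
begin

lemma subfield_0: "0 \<in> K"
  and subfield_1: "1 \<in> K"
  and subfield_add: "x \<in> K \<Longrightarrow> y \<in> K \<Longrightarrow> x + y \<in> K"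
  and subfield_mult: "x \<in> K \<Longrightarrow> y \<in> K \<Longrightarrow> x * y \<in> K"
  and subfield_uminus: "x \<in> K \<Longrightarrow> - x \<in> K"
  using subringE[OF subfieldE(1)[OF K]] by auto

lemma subfield_diff: "x \<in> K \<Longrightarrow> y \<in> K \<Longrightarrow> x - y \<in> K"
  using subfield_add[of x "- y"] subfield_uminus by auto

lemma subfield_inverse: "x \<in> K \<Longrightarrow> inverse x \<in> K"
  using kbar.subfield_m_inv(1)[OF K, of x] by (cases "x = 0") auto

lemma subfield_divide: "x \<in> K \<Longrightarrow> y \<in> K \<Longrightarrow> x / y \<in> K"
  using subfield_mult[of x "inverse y"] subfield_inverse by (auto simp: divide_inverse)

lemma subfield_sum: "(\<And>i. i \<in> I \<Longrightarrow> f i \<in> K) \<Longrightarrow> sum f I \<in> K"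
  by (induction I rule: infinite_finite_induct) (auto simp: subfield_0 subfield_add)

end

lemmas subfield_closed =
  subfield_0 subfield_1 subfield_add subfield_mult subfield_uminus subfield_diff
  subfield_inverse subfield_divide

lemma subfield_base_field: "subfield base_field (kbar :: 'k::field alg_closure ring)"
proof (rule subfieldI_kbar)
  show "1 \<in> (base_field :: 'k alg_closure set)"
    unfolding base_field_def by (metis rangeI to_ac_1)
qed (auto simp: base_field_def simp flip: to_ac_add to_ac_mult to_ac_minus to_ac_inverse)

section \<open>Counting embeddings\<close>

text \<open>No codomain and no extensionality: one function then serves for every subfield of
  \<open>L\<close>. The unit is preserved because 1 lies in \<open>base_field\<close>.\<close>

definition k_hom :: "'k::field alg_closure set \<Rightarrow> ('k alg_closure \<Rightarrow> 'k alg_closure) \<Rightarrow> bool" where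
  "k_hom L s \<longleftrightarrow> (\<forall>x\<in>L. \<forall>y\<in>L. s (x + y) = s x + s y \<and> s (x * y) = s x * s y) \<and>
     (\<forall>c\<in>base_field. s c = c)"

lemma k_hom_subset: "k_hom L s \<Longrightarrow> K \<subseteq> L \<Longrightarrow> k_hom K s"
  unfolding k_hom_def by blast

lemma k_hom_cong: "base_field \<subseteq> L \<Longrightarrow> subfield L kbar \<Longrightarrow> (\<And>x. x \<in> L \<Longrightarrow> s x = t x) \<Longrightarrow> k_hom L s \<longleftrightarrow> k_hom L t"
  unfolding k_hom_def by (simp add: subset_iff subfield_closed)

lemma k_hom_id: "k_hom L (\<lambda>x. x)"
  by (simp add: k_hom_def)

lemma k_hom_comp:
  "k_hom L s \<Longrightarrow> k_hom M t \<Longrightarrow> s ` L \<subseteq> M \<Longrightarrow> k_hom L (\<lambda>x. t (s x))"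
  unfolding k_hom_def image_subset_iff by auto

text \<open>Partial homomorphisms cover both the embeddings of finite extensions and the
  automorphisms of the closure (\<open>L = UNIV\<close>), so that each rationality argument is made
  only once.\<close>

locale subfield_hom =
  fixes L :: "'k::field alg_closure set" and s :: "'k alg_closure \<Rightarrow> 'k alg_closure"
  assumes subfield: "subfield L kbar" and base: "base_field \<subseteq> L" and hom: "k_hom L s"
begin

lemma hom_add: "x \<in> L \<Longrightarrow> y \<in> L \<Longrightarrow> s (x + y) = s x + s y"
  and hom_mult: "x \<in> L \<Longrightarrow> y \<in> L \<Longrightarrow> s (x * y) = s x * s y"
  and hom_base: "c \<in> base_field \<Longrightarrow> s c = c"
  using hom by (auto simp: k_hom_def)

lemma hom_0 [simp]: "s 0 = 0" and hom_1 [simp]: "s 1 = 1"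
  by (simp_all add: hom_base subfield_closed subfield_base_field)

lemma hom_uminus: "x \<in> L \<Longrightarrow> s (- x) = - s x"
  using hom_add[of x "- x"] subfield_uminus[OF subfield, of x] by (simp add: eq_neg_iff_add_eq_0 add.commute)

lemma hom_diff: "x \<in> L \<Longrightarrow> y \<in> L \<Longrightarrow> s (x - y) = s x - s y"
  using hom_add[of x "- y"] subfield_uminus[OF subfield, of y] by (simp add: hom_uminus)

lemma hom_eq_0_iff: "x \<in> L \<Longrightarrow> s x = 0 \<longleftrightarrow> x = 0"
  using hom_mult[of x "inverse x"] subfield_inverse[OF subfield, of x] by (cases "x = 0") auto

lemma hom_inj: "inj_on s L"
proof (rule inj_onI)
  fix x y assume "x \<in> L" "y \<in> L" "s x = s y"
  then have "s (x - y) = 0" by (simp add: hom_diff)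
  then show "x = y"
    using hom_eq_0_iff[of "x - y"] subfield_diff[OF subfield] \<open>x \<in> L\<close> \<open>y \<in> L\<close> by auto
qed

lemma hom_inverse: "x \<in> L \<Longrightarrow> s (inverse x) = inverse (s x)"
  using hom_mult[of x "inverse x"] subfield_inverse[OF subfield, of x] hom_eq_0_iff[of x]
  by (cases "x = 0") (auto simp: field_simps)

lemma hom_divide: "x \<in> L \<Longrightarrow> y \<in> L \<Longrightarrow> s (x / y) = s x / s y"
  by (simp add: divide_inverse hom_mult hom_inverse subfield_inverse[OF subfield])

lemma hom_sum: "(\<And>i. i \<in> I \<Longrightarrow> f i \<in> L) \<Longrightarrow> s (sum f I) = (\<Sum>i\<in>I. s (f i))"
  by (induction I rule: infinite_finite_induct)
    (auto simp: hom_add subfield_sum[OF subfield])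

lemma image_subfield: "subfield (s ` L) kbar"
proof (rule subfieldI_kbar)
  show "1 \<in> s ` L" using hom_1 subfield_1[OF subfield] by force
qed (auto simp: subfield_closed[OF subfield] simp flip: hom_add hom_mult hom_uminus hom_inverse)

lemma base_subset_image: "base_field \<subseteq> s ` L"
  using hom_base base by force

end

lemma embeddings_iff:
  assumes "base_field \<subseteq> K" "subfield K kbar"
  shows "\<tau> \<in> embeddings K L \<longleftrightarrow> \<tau> \<in> extensional K \<and> k_hom K \<tau> \<and> \<tau> ` K \<subseteq> L"
proof -
  have "1 \<in> (base_field :: 'a alg_closure set)"
    by (rule subfield_1[OF subfield_base_field])
  then show ?thesis
    unfolding embeddings_def k_hom_def ring_hom_def by auto
qed

section \<open>Polynomials with coefficients in a subfield\<close>

definition poly_over :: "'a::zero set \<Rightarrow> 'a poly \<Rightarrow> bool" where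
  "poly_over K p \<longleftrightarrow> (\<forall>i. Polynomial.coeff p i \<in> K)"

lemma poly_over_pCons [simp]: "poly_over K (pCons a p) \<longleftrightarrow> a \<in> K \<and> poly_over K p"
  unfolding poly_over_def by (metis coeff_pCons_0 coeff_pCons_Suc not0_implies_Suc)

context
  fixes K :: "'k::field alg_closure set"
  assumes K: "subfield K kbar"
begin

lemma poly_over_0: "poly_over K 0"
  by (simp add: poly_over_def subfield_0[OF K])

lemma poly_over_add: "poly_over K p \<Longrightarrow> poly_over K q \<Longrightarrow> poly_over K (p + q)"
  and poly_over_diff: "poly_over K p \<Longrightarrow> poly_over K q \<Longrightarrow> poly_over K (p - q)"
  and poly_over_smult: "c \<in> K \<Longrightarrow> poly_over K p \<Longrightarrow> poly_over K (Polynomial.smult c p)"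
  and poly_over_mult: "poly_over K p \<Longrightarrow> poly_over K q \<Longrightarrow> poly_over K (p * q)"
  by (auto simp: poly_over_def coeff_mult intro!: subfield_closed[OF K] subfield_sum[OF K])

lemma poly_in_subfield: "poly_over K p \<Longrightarrow> x \<in> K \<Longrightarrow> poly p x \<in> K"
  by (induction p) (auto simp: subfield_closed[OF K])

text \<open>Dividing by a monic polynomial involves no inverses, so quotient and remainder keep
  their coefficients in \<open>K\<close>. The remainder is bounded through its coefficients rather
  than its degree, so that a zero remainder and a constant \<open>m\<close> are no
  exceptions.\<close>

lemma poly_over_division:
  assumes m: "poly_over K m" "Polynomial.lead_coeff m = 1" and p: "poly_over K p"
  obtains q r where "poly_over K q" "poly_over K r" "p = m * q + r"
    "\<And>i. i \<ge> Polynomial.degree m \<Longrightarrow> Polynomial.coeff r i = 0"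
proof -
  let ?n = "Polynomial.degree m"
  have "\<exists>q r. poly_over K q \<and> poly_over K r \<and> p = m * q + r \<and>
    (\<forall>i\<ge>?n. Polynomial.coeff r i = 0)" using p
  proof (induction p)
    case 0
    show ?case by (rule exI[of _ 0], rule exI[of _ 0]) (simp add: poly_over_0)
  next
    case (pCons a p)
    then obtain q r where qr: "poly_over K q" "poly_over K r" "p = m * q + r"
      "\<forall>i\<ge>?n. Polynomial.coeff r i = 0" by auto
    \<comment> \<open>Horner step: a + X p = m (X q) + (a + X r). The last summand may reach degree
      \<open>?n\<close>; its coefficient \<open>c\<close> there is cancelled by subtracting
      \<open>c\<close> times \<open>m\<close>.\<close>
    define r' where "r' = pCons a r"
    define c where "c = Polynomial.coeff r' ?n"
    have r': "poly_over K r'" using pCons.prems qr by (simp add: r'_def)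
    have c: "c \<in> K" using r' by (simp add: poly_over_def c_def)
    have "pCons a p = m * pCons c q + (r' - Polynomial.smult c m)"
      by (simp add: qr(3) r'_def)
    moreover have "Polynomial.coeff (r' - Polynomial.smult c m) i = 0" if "i \<ge> ?n" for i
    proof (cases "i = ?n")
      case True then show ?thesis using m by (simp add: c_def)
    next
      case False
      then have "i > ?n" using that by simp
      then show ?thesis using qr(4)
        by (cases i) (auto simp: r'_def coeff_eq_0)
    qed
    ultimately show ?case
      using c qr(1) poly_over_diff[OF r' poly_over_smult[OF c m(1)]] by (metis poly_over_pCons)
  qed
  then show ?thesis using that by blast
qed

end

context subfield_hom
begin

lemma coeff_map_hom [simp]: "Polynomial.coeff (map_poly s p) i = s (Polynomial.coeff p i)"
  by (simp add: coeff_map_poly)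

lemma map_hom_add:
  "poly_over L p \<Longrightarrow> poly_over L q \<Longrightarrow> map_poly s (p + q) = map_poly s p + map_poly s q"
  by (rule poly_eqI) (simp add: poly_over_def hom_add)

lemma map_hom_diff:
  "poly_over L p \<Longrightarrow> poly_over L q \<Longrightarrow> map_poly s (p - q) = map_poly s p - map_poly s q"
  by (rule poly_eqI) (simp add: poly_over_def hom_diff)

lemma map_hom_mult:
  "poly_over L p \<Longrightarrow> poly_over L q \<Longrightarrow> map_poly s (p * q) = map_poly s p * map_poly s q"
  by (rule poly_eqI)
    (simp add: poly_over_def coeff_mult hom_sum hom_mult subfield_mult[OF subfield])

lemma poly_map_hom:
  "poly_over L p \<Longrightarrow> x \<in> L \<Longrightarrow> poly (map_poly s p) (s x) = s (poly p x)"
  by (induction p)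
    (auto simp: map_poly_pCons hom_add hom_mult poly_in_subfield[OF subfield]
       subfield_mult[OF subfield])

lemma degree_map_hom: "poly_over L p \<Longrightarrow> Polynomial.degree (map_poly s p) = Polynomial.degree p"
proof -
  assume "poly_over L p"
  then have "Polynomial.coeff p i = 0 \<longleftrightarrow> Polynomial.coeff (map_poly s p) i = 0" for i
    by (simp add: poly_over_def hom_eq_0_iff)
  then show ?thesis
    by (intro antisym degree_le) (metis coeff_eq_0)+
qed

end

text \<open>HOL-Algebra lists coefficients from the leading one down, \<open>Poly\<close> from the
  constant one up; hence the reversal. Through this bridge \<open>Irr\<close> and the dimension of
  \<open>simple_extension\<close> become available for ordinary polynomials.\<close>

lemma kbar_eval: "kbar.eval p x = poly (Poly (rev p)) x"
  by (induction p) (auto simp: Poly_append poly_monom)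

lemma coeffs_in_univ_poly:
  assumes "poly_over K p"
  shows "rev (coeffs p) \<in> carrier (K[X]\<^bsub>kbar\<^esub>)"
proof (cases "p = 0")
  case False
  have "set (coeffs p) \<subseteq> K" using assms by (auto simp: poly_over_def coeffs_def)
  moreover have "hd (rev (coeffs p)) \<noteq> 0"
    using False by (simp add: hd_rev last_coeffs_eq_coeff_degree)
  ultimately show ?thesis by (simp add: univ_poly_def polynomial_def)
qed (simp add: univ_poly_def polynomial_def)

lemma algebraic_over_subfield:
  fixes x :: "'k::field alg_closure"
  assumes "base_field \<subseteq> K"
  shows "(kbar.algebraic over K) x"
proof -
  obtain p :: "'k poly" where p: "p \<noteq> 0" "poly (map_poly to_ac p) x = 0"
    by (rule alg_closure_algebraic)
  let ?p = "map_poly to_ac p"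
  have "?p \<noteq> 0" using p by (auto simp: map_poly_eq_0_iff)
  moreover have "poly_over K ?p"
    using assms by (auto simp: poly_over_def coeff_map_poly base_field_def)
  ultimately show ?thesis
    using kbar.algebraicI[OF coeffs_in_univ_poly, of K ?p x] p by (simp add: kbar_eval)
qed

text \<open>The polynomial is \<open>Irr\<close> with reversed coefficients, so its degree is the
  known dimension. Divisibility follows from \<open>poly_over_division\<close>: a nonzero remainder
  would vanish at x and have too small a degree.\<close>

lemma minimal_polynomial:
  fixes x :: "'k::field alg_closure"
  assumes K: "subfield K kbar" "base_field \<subseteq> K"
  obtains m where "poly_over K m" "Polynomial.lead_coeff m = 1" "poly m x = 0"
    "Polynomial.degree m = kbar.dim K (kbar.simple_extension K x)"
    "\<And>p. poly_over K p \<Longrightarrow> poly p x = 0 \<Longrightarrow> \<exists>q. poly_over K q \<and> p = m * q"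
proof -
  have alg: "(kbar.algebraic over K) x" by (rule algebraic_over_subfield[OF K(2)])
  define l where "l = kbar.Irr K x"
  note Irr = kbar.IrrE[OF K(1) _ alg, folded l_def]
  have l: "l \<in> carrier (K[X]\<^bsub>kbar\<^esub>)" "Polynomials.lead_coeff l = 1" "kbar.eval l x = 0"
    using Irr by auto
  have "l \<noteq> []" using kbar.pirreducible_degree[OF K(1), of l] Irr by force
  have lK: "set l \<subseteq> K" using l(1) by (auto simp: univ_poly_def polynomial_def)
  define m where "m = Poly (rev l)"
  have coeffm: "Polynomial.coeff m i = (if i < length l then l ! (length l - 1 - i) else 0)" for i
    by (auto simp: m_def nth_default_def rev_nth)
  have m: "poly_over K m"
    using lK by (auto simp: poly_over_def coeffm subfield_0[OF K(1)])
  have top: "Polynomial.coeff m (length l - 1) = 1"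
    using l(2) \<open>l \<noteq> []\<close> by (simp add: coeffm hd_conv_nth)
  have deg: "Polynomial.degree m = length l - 1"
  proof (rule antisym)
    show "Polynomial.degree m \<le> length l - 1"
      by (rule degree_le) (auto simp: coeffm)
    show "length l - 1 \<le> Polynomial.degree m"
      by (rule le_degree) (metis top zero_neq_one)
  qed
  have rt: "poly m x = 0" using l(3) by (simp add: m_def kbar_eval)
  have low: "Polynomial.degree m \<le> Polynomial.degree p"
    if p: "poly_over K p" "poly p x = 0" "p \<noteq> 0" for p
  proof -
    have ev: "kbar.eval (rev (coeffs p)) x = 0" using p by (simp add: kbar_eval)
    have "l pdivides\<^bsub>kbar\<^esub> rev (coeffs p)"
      using kbar.Irr_minimal[OF K(1) _ alg coeffs_in_univ_poly[OF p(1)]] ev by (simp add: l_def)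
    then have "Polynomials.degree l \<le> Polynomials.degree (rev (coeffs p))"
      using kbar.pdivides_imp_degree_le[OF subfieldE(1)[OF K(1)] l(1) coeffs_in_univ_poly[OF p(1)]]
        p(3) by simp
    then show ?thesis unfolding deg using p(3) by (simp add: degree_eq_length_coeffs[of p])
  qed
  show ?thesis
  proof (rule that[OF m _ rt])
    show "Polynomial.lead_coeff m = 1" using top deg by simp
    show "Polynomial.degree m = kbar.dim K (kbar.simple_extension K x)"
      using kbar.simple_extension_dim[OF K(1) _ alg] by (simp add: over_def deg l_def)
    fix p assume p: "poly_over K p" "poly p x = 0"
    obtain q r where qr: "poly_over K q" "poly_over K r" "p = m * q + r"
      "\<And>i. i \<ge> Polynomial.degree m \<Longrightarrow> Polynomial.coeff r i = 0"
      using poly_over_division[OF K(1) m \<open>Polynomial.lead_coeff m = 1\<close> p(1)] by blast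
    have "poly r x = 0" using qr(3) p(2) rt by simp
    have "r = 0"
    proof (rule ccontr)
      assume "r \<noteq> 0"
      then have "Polynomial.coeff r (Polynomial.degree r) = 0"
        using low[OF qr(2) \<open>poly r x = 0\<close>] qr(4) by blast
      then show False using \<open>r \<noteq> 0\<close> by simp
    qed
    then show "\<exists>q. poly_over K q \<and> p = m * q" using qr by auto
  qed
qed

section \<open>Separability\<close>

lemma card_roots_rsquarefree:
  fixes p :: "'a::alg_closed_field poly"
  assumes "rsquarefree p"
  shows "card {x. poly p x = 0} = Polynomial.degree p"
proof -
  have p0: "p \<noteq> 0" using assms by (simp add: rsquarefree_def)
  obtain A where A: "size A = Polynomial.degree p"
    "p = Polynomial.smult (Polynomial.lead_coeff p) (\<Prod>x\<in>#A. [:- x, 1:])"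
    using alg_closed_imp_factorization[OF p0] by blast
  have "proots p = A"
  proof -
    have "proots p = proots (\<Prod>x\<in>#A. [:- x, 1:])"
      using p0 by (subst A(2)) simp
    also have "\<dots> = A"
      by (subst proots_prod_mset[of "{#[:- x, 1:]. x \<in># A#}", simplified])
        (auto simp: image_mset.compositionality o_def)
    finally show ?thesis .
  qed
  moreover have "size (proots p) = (\<Sum>x | poly p x = 0. order x p)"
    using p0 by (simp add: size_multiset_overloaded_eq)
  moreover have "\<dots> = (\<Sum>x | poly p x = 0. 1)"
    using assms p0 by (intro sum.cong) (auto simp: rsquarefree_root_order)
  ultimately show ?thesis using A(1) by simp
qed

lemma rsquarefree_dvd:
  assumes "rsquarefree (p * q)"
  shows "rsquarefree p"
proof -
  have "p * q \<noteq> 0" using assms by (simp add: rsquarefree_def)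
  then show ?thesis
    using assms unfolding rsquarefree_def by (auto simp: order_mult)
qed

text \<open>This is where perfectness of k enters. The squarefree polynomial has coefficients in k,
  yet serves every larger field \<open>K\<close>: the minimal polynomial over \<open>K\<close>
  divides it and is therefore squarefree too.\<close>

lemma separable_polynomial:
  fixes x :: "'k::field alg_closure"
  assumes "perfect_field TYPE('k)"
  obtains p :: "'k poly" where "poly (map_poly to_ac p) x = 0" "rsquarefree (map_poly to_ac p)"
proof -
  let ?Q = "\<lambda>p :: 'k poly. p \<noteq> 0 \<and> poly (map_poly to_ac p) x = 0"
  obtain p0 where "?Q p0" using alg_closure_algebraic by blast
  then obtain p where p: "?Q p" and min: "\<And>q. ?Q q \<Longrightarrow> Polynomial.degree p \<le> Polynomial.degree q"
    by (rule ex_has_least_nat[of ?Q _ Polynomial.degree, THEN exE]) blast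
  have map_mult: "map_poly to_ac (a * b) = map_poly to_ac a * map_poly to_ac b" for a b :: "'k poly"
    by (rule poly_eqI) (simp add: coeff_map_poly coeff_mult to_ac_sum)
  \<comment> \<open>Least degree forces irreducibility: one factor vanishes at x, so it already has
    the full degree and the other factor is constant.\<close>
  have "Factorial_Ring.irreducible p"
  proof (rule Factorial_Ring.irreducibleI)
    show "p \<noteq> 0" using p by simp
    show "\<not> p dvd 1"
    proof
      assume "p dvd 1"
      then obtain c where "p = [:c:]" by (auto simp: is_unit_poly_iff)
      then show False using p by (auto simp: map_poly_pCons)
    qed
    fix a b assume ab: "p = a * b"
    then have nz: "a \<noteq> 0" "b \<noteq> 0" using p by auto
    have deg: "Polynomial.degree p = Polynomial.degree a + Polynomial.degree b"
      using ab nz by (simp add: degree_mult_eq)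
    have unit: "c dvd 1" if "Polynomial.degree c = 0" "c \<noteq> 0" for c :: "'k poly"
      using that by (simp add: is_unit_iff_degree)
    have "poly (map_poly to_ac a) x = 0 \<or> poly (map_poly to_ac b) x = 0"
      using p by (simp add: ab map_mult)
    then show "a dvd 1 \<or> b dvd 1"
      using min[of a] min[of b] nz deg unit by fastforce
  qed
  then show ?thesis using that p assms by (auto simp: perfect_field_def)
qed

section \<open>Extensions of an embedding\<close>

text \<open>An arbitrary \<open>s\<close> on \<open>K\<close>, instead of the inclusion, lets the
  count run up a tower of fields. Extensionality makes distinct elements differ on \<open>L\<close>,
  so that cardinalities are meaningful.\<close>

definition extensions ::
  "'k::field alg_closure set \<Rightarrow> 'k alg_closure set \<Rightarrow> ('k alg_closure \<Rightarrow> 'k alg_closure) \<Rightarrow>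
   ('k alg_closure \<Rightarrow> 'k alg_closure) set" where
  "extensions K L s = {t \<in> extensional L. k_hom L t \<and> (\<forall>c\<in>K. t c = s c)}"


lemma subfield_hom_extension:
  assumes "subfield L kbar" "base_field \<subseteq> L" "t \<in> extensions K L s"
  shows "subfield_hom L t"
  using assms by (intro subfield_hom.intro) (auto simp: extensions_def)

lemma simple_extension_facts:
  fixes x :: "'k::field alg_closure"
  assumes K: "subfield K kbar" "base_field \<subseteq> K"
  shows subfield_simple_extension: "subfield (kbar.simple_extension K x) kbar"
    and subset_simple_extension: "K \<subseteq> kbar.simple_extension K x"
    and mem_simple_extension: "x \<in> kbar.simple_extension K x"
    and finite_dimension_simple_extension: "kbar.finite_dimension K (kbar.simple_extension K x)"
  using kbar.simple_extension_is_subfield[OF K(1), of x] algebraic_over_subfield[OF K(2), of x]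
    kbar.simple_extension_incl[of K x] kbar.simple_extension_mem[OF subfieldE(1)[OF K(1)], of x]
    kbar.finite_dimension_simple_extension[OF K(1), of x]
  by auto

lemma simple_extension_eq:
  "kbar.simple_extension K x = {poly p x | p. poly_over K p}" if K: "subfield K kbar"
proof -
  have "kbar.eval l x \<in> {poly p x | p. poly_over K p}" if "l \<in> carrier (K[X]\<^bsub>kbar\<^esub>)" for l
  proof -
    have "set l \<subseteq> K" using that by (auto simp: univ_poly_def polynomial_def)
    then have "poly_over K (Poly (rev l))"
      by (auto simp: poly_over_def nth_default_def rev_nth subfield_0[OF K])
    then show ?thesis by (auto simp: kbar_eval)
  qed
  moreover have "poly p x \<in> (\<lambda>l. kbar.eval l x) ` carrier (K[X]\<^bsub>kbar\<^esub>)" if "poly_over K p" for p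
    using coeffs_in_univ_poly[OF that] by (auto simp: kbar_eval intro!: image_eqI[of _ _ "rev (coeffs p)"])
  ultimately show ?thesis
    using kbar.simple_extension_as_eval_img[of K x] by auto
qed

text \<open>The classical bijection t \<mapsto> t x onto the roots of the minimal polynomial
  transported by \<open>s\<close>.\<close>

lemma card_extensions_simple:
  fixes x :: "'k::field alg_closure"
  assumes perfect: "perfect_field TYPE('k)" and "subfield_hom K s"
  defines "M \<equiv> kbar.simple_extension K x"
  shows "finite (extensions K M s)" "card (extensions K M s) = kbar.dim K M"
proof -
  interpret subfield_hom K s by fact
  note M = simple_extension_facts[OF subfield base, of x, folded M_def]
  have baseM: "base_field \<subseteq> M" using base M(2) by simp
  obtain m where m: "poly_over K m" "Polynomial.lead_coeff m = 1" "poly m x = 0"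
    "Polynomial.degree m = kbar.dim K M"
    and dvd: "\<And>p. poly_over K p \<Longrightarrow> poly p x = 0 \<Longrightarrow> \<exists>q. poly_over K q \<and> p = m * q"
    using minimal_polynomial[OF subfield base, of x] unfolding M_def by blast
  define R where "R = {y. poly (map_poly s m) y = 0}"
  have mapM: "t (poly p x) = poly (map_poly s p) (t x)"
    if t: "t \<in> extensions K M s" and p: "poly_over K p" for t p
  proof -
    interpret t: subfield_hom M t by (rule subfield_hom_extension[OF M(1) baseM t])
    have "map_poly t p = map_poly s p"
      using t p by (intro poly_eqI) (auto simp: extensions_def poly_over_def)
    then show ?thesis
      using t.poly_map_hom[of p x] p M(2,3) by (simp add: poly_over_def subset_iff)
  qed
  have "map_poly s m \<noteq> 0"
    using m(2) by (metis coeff_map_hom hom_1 coeff_0 zero_neq_one)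
  then have finR: "finite R" unfolding R_def by (rule poly_roots_finite)
  \<comment> \<open>\<open>m\<close> divides a squarefree polynomial over k, whose coefficients are
    fixed by \<open>s\<close>. The transported \<open>m\<close> divides the same polynomial, so it
    has as many roots as its degree.\<close>
  have cardR: "card R = kbar.dim K M"
  proof -
    obtain p :: "'k poly" where p: "poly (map_poly to_ac p) x = 0" "rsquarefree (map_poly to_ac p)"
      by (rule separable_polynomial[OF perfect])
    let ?p = "map_poly to_ac p"
    have "poly_over K ?p"
      using base by (auto simp: poly_over_def coeff_map_poly base_field_def)
    then obtain q where q: "poly_over K q" "?p = m * q" using dvd p(1) by blast
    have "map_poly s ?p = ?p"
      by (rule poly_eqI) (simp add: coeff_map_poly hom_base base_field_def)
    then have "rsquarefree (map_poly s m * map_poly s q)"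
      using p(2) q map_hom_mult[OF m(1) q(1)] by simp
    then show ?thesis
      unfolding R_def using card_roots_rsquarefree rsquarefree_dvd degree_map_hom[OF m(1)] m(4)
      by metis
  qed
  have "bij_betw (\<lambda>t. t x) (extensions K M s) R"
  proof (rule bij_betw_imageI)
    show "inj_on (\<lambda>t. t x) (extensions K M s)"
    proof (rule inj_onI)
      fix t u assume tu: "t \<in> extensions K M s" "u \<in> extensions K M s" "t x = u x"
      show "t = u"
      proof (rule extensionalityI[of _ M])
        fix z assume "z \<in> M"
        then show "t z = u z"
          using mapM[OF tu(1)] mapM[OF tu(2)] tu(3)
          by (auto simp: M_def simple_extension_eq[OF subfield])
      qed (use tu in \<open>auto simp: extensions_def\<close>)
    qed
    show "(\<lambda>t. t x) ` extensions K M s = R"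
    proof (intro equalityI subsetI)
      fix y assume "y \<in> (\<lambda>t. t x) ` extensions K M s"
      then obtain t where t: "t \<in> extensions K M s" "y = t x" by blast
      interpret t: subfield_hom M t by (rule subfield_hom_extension[OF M(1) baseM t(1)])
      show "y \<in> R" using mapM[OF t(1) m(1)] m(3) t(2) by (simp add: R_def)
    next
      fix y assume y: "y \<in> R"
      \<comment> \<open>For a root y, send p(x) to the value at y of the transported p. The choice
        of p is harmless: two choices differ by a multiple of \<open>m\<close>, whose transport
        vanishes at y.\<close>
      define f where "f = (\<lambda>z\<in>M. poly (map_poly s (SOME p. poly_over K p \<and> poly p x = z)) y)"
      have f: "f (poly p x) = poly (map_poly s p) y" if p: "poly_over K p" for p
      proof -
        define p' where "p' = (SOME p'. poly_over K p' \<and> poly p' x = poly p x)"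
        have p': "poly_over K p' \<and> poly p' x = poly p x"
          unfolding p'_def by (rule someI[of _ p]) (simp add: p)
        then have "poly_over K (p' - p)" "poly (p' - p) x = 0"
          using p poly_over_diff[OF subfield] by auto
        then obtain q where q: "poly_over K q" "p' - p = m * q" using dvd by blast
        have "map_poly s p' - map_poly s p = map_poly s m * map_poly s q"
          using p' p q map_hom_diff[of p' p] map_hom_mult[OF m(1) q(1)] by simp
        then have "poly (map_poly s p') y - poly (map_poly s p) y = 0"
          using y by (simp flip: poly_diff add: R_def)
        moreover have "poly p x \<in> M" using p by (auto simp: M_def simple_extension_eq[OF subfield])
        ultimately show ?thesis by (simp add: f_def p'_def)
      qed
      have fK: "f c = s c" if "c \<in> K" for c
        using f[of "[:c:]"] that by (simp add: poly_over_0[OF subfield] map_poly_pCons)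
      have fx: "f x = y"
        using f[of "[:0, 1:]"]
        by (simp add: poly_over_0[OF subfield] subfield_closed[OF subfield] map_poly_pCons)
      have "k_hom M f"
        unfolding k_hom_def
      proof (intro conjI ballI)
        fix a b assume "a \<in> M" "b \<in> M"
        then obtain p q where pq: "poly_over K p" "poly_over K q" "a = poly p x" "b = poly q x"
          by (auto simp: M_def simple_extension_eq[OF subfield])
        show "f (a + b) = f a + f b"
          using f[OF poly_over_add[OF subfield pq(1,2)]] f pq by (simp add: map_hom_add)
        show "f (a * b) = f a * f b"
          using f[OF poly_over_mult[OF subfield pq(1,2)]] f pq by (simp add: map_hom_mult)
      qed (use fK hom_base base in auto)
      then have "f \<in> extensions K M s"
        using fK by (simp add: extensions_def f_def)
      then show "y \<in> (\<lambda>t. t x) ` extensions K M s" using fx by force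
    qed
  qed
  then show "finite (extensions K M s)" "card (extensions K M s) = kbar.dim K M"
    using finR cardR bij_betw_finite bij_betw_same_card by metis+
qed

lemma finite_extension_facts:
  fixes xs :: "'k::field alg_closure list"
  assumes K: "subfield K kbar" "base_field \<subseteq> K"
  shows subfield_finite_extension: "subfield (kbar.finite_extension K xs) kbar"
    and subset_finite_extension: "K \<subseteq> kbar.finite_extension K xs"
    and finite_dimension_finite_extension: "kbar.finite_dimension K (kbar.finite_extension K xs)"
  using kbar.finite_extension_is_subfield[OF K(1), of xs] algebraic_over_subfield[OF K(2)]
    kbar.finite_extension_incl[of K xs] kbar.finite_extension_finite_dimension(1)[OF K(1), of xs]
  by auto

text \<open>The generators are adjoined one at a time: restriction to the smaller field
  \<open>M\<close> splits the extensions into fibres of equal size, which matches the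
  multiplicativity of dimensions in towers.\<close>

lemma card_extensions_finite_extension:
  fixes xs :: "'k::field alg_closure list"
  assumes perfect: "perfect_field TYPE('k)" and s: "subfield_hom K s"
  shows "finite (extensions K (kbar.finite_extension K xs) s) \<and>
    card (extensions K (kbar.finite_extension K xs) s) = kbar.dim K (kbar.finite_extension K xs)"
proof (induction xs)
  interpret subfield_hom K s by fact
  case Nil
  have "extensions K K s = {restrict s K}"
    using hom k_hom_cong[OF base subfield, of "restrict s K" s]
    by (auto simp: extensions_def intro!: extensionalityI[of _ K])
  then show ?case
    using kbar.dimI[OF subfield kbar.dimension_one[OF subfield]] by (simp add: over_def)
next
  interpret subfield_hom K s by fact
  case (Cons x xs)
  define M where "M = kbar.finite_extension K xs"
  define N where "N = kbar.simple_extension M x"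
  note M = finite_extension_facts[OF subfield base, of xs, folded M_def]
  have baseM: "base_field \<subseteq> M" using base M(2) by simp
  note N = simple_extension_facts[OF M(1) baseM, of x, folded N_def]
  have IH: "finite (extensions K M s)" "card (extensions K M s) = kbar.dim K M"
    using Cons by (auto simp: M_def)
  have ext: "finite (extensions M N t) \<and> card (extensions M N t) = kbar.dim M N"
    if t: "t \<in> extensions K M s" for t
    using card_extensions_simple[OF perfect subfield_hom_extension[OF M(1) baseM t], of x]
    by (simp add: N_def)
  have eq: "extensions K N s = (\<Union>t\<in>extensions K M s. extensions M N t)"
  proof (intro equalityI subsetI)
    fix u assume u: "u \<in> extensions K N s"
    have "restrict u M \<in> extensions K M s"
      using u N(2) M(2) k_hom_cong[OF baseM M(1), of "restrict u M" u] k_hom_subset[of N u M]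
      by (auto simp: extensions_def)
    moreover have "u \<in> extensions M N (restrict u M)" using u by (auto simp: extensions_def)
    ultimately show "u \<in> (\<Union>t\<in>extensions K M s. extensions M N t)" by blast
  next
    fix u assume "u \<in> (\<Union>t\<in>extensions K M s. extensions M N t)"
    then show "u \<in> extensions K N s" using M(2) by (auto simp: extensions_def)
  qed
  have disj: "extensions M N t \<inter> extensions M N t' = {}"
    if "t \<in> extensions K M s" "t' \<in> extensions K M s" "t \<noteq> t'" for t t'
  proof (rule ccontr)
    assume "extensions M N t \<inter> extensions M N t' \<noteq> {}"
    then obtain u where "u \<in> extensions M N t" "u \<in> extensions M N t'" by blast
    then have "t z = t' z" if "z \<in> M" for z using that by (simp add: extensions_def)
    then have "t = t'"
      using that(1,2) by (intro extensionalityI[of _ M]) (auto simp: extensions_def)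
    then show False using that(3) by simp
  qed
  have "card (extensions K N s) = (\<Sum>t\<in>extensions K M s. card (extensions M N t))"
    unfolding eq using IH ext disj by (intro card_UN_disjoint) auto
  also have "\<dots> = kbar.dim K M * kbar.dim M N" using IH ext by simp
  also have "\<dots> = kbar.dim K N"
    using kbar.telescopic_base_dim(2)[OF subfield M(1,3) N(4)] by (simp add: over_def)
  finally have "card (extensions K N s) = kbar.dim K N" .
  moreover have "finite (extensions K N s)" unfolding eq using IH ext by auto
  ultimately show ?case by (simp add: M_def N_def)
qed

section \<open>Intermediate fields of finite extensions\<close>

lemma subalgebra_subfield:
  assumes "subfield K kbar" "subfield L kbar" "K \<subseteq> L"
  shows "subalgebra K L kbar"
  using assms subring.axioms(1)[OF subfieldE(1)[OF assms(2)]] subfield_mult[OF assms(2)]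
  unfolding subalgebra_def subalgebra_axioms_def by auto

lemma finite_dimension_lower:
  assumes "subfield K kbar" "subfield F kbar" "K \<subseteq> F" "F \<subseteq> L" "kbar.finite_dimension K L"
  shows "kbar.finite_dimension K F"
  using kbar.subalbegra_incl_imp_finite_dimension[OF assms(1,5)] subalgebra_subfield assms by blast

text \<open>A family spanning \<open>L\<close> over \<open>K\<close> also spans it over the larger
  field \<open>F\<close>.\<close>

lemma finite_dimension_upper:
  assumes K: "subfield K kbar" and F: "subfield F kbar" and L: "subfield L kbar"
    and sub: "K \<subseteq> F" "F \<subseteq> L" and fin: "kbar.finite_dimension K L"
  shows "kbar.finite_dimension F L"
proof -
  obtain Us where Us: "kbar.Span K Us = L"
    using fin kbar.exists_base[OF K] by blast
  have incl: "set Us \<subseteq> L" using kbar.Span_base_incl[OF K, of Us] Us by simp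
  have "kbar.Span F Us \<subseteq> L"
    using kbar.subalgebra_Span_incl[OF F subalgebra_subfield[OF F L sub(2)] incl] .
  moreover have "L \<subseteq> kbar.Span F Us"
  proof -
    have "subalgebra F (kbar.Span F Us) kbar" by (rule kbar.Span_is_subalgebra[OF F]) simp
    then have "subalgebra K (kbar.Span F Us) kbar"
      using sub(1) unfolding subalgebra_def subalgebra_axioms_def by auto
    then show ?thesis
      using kbar.subalgebra_Span_incl[OF K, of _ Us] kbar.Span_base_incl[OF F, of Us] Us by simp
  qed
  ultimately show ?thesis using kbar.Span_finite_dimension[OF F, of Us] by simp
qed

lemma finite_dimension_generators:
  assumes K: "subfield K kbar" and L: "subfield L kbar" "K \<subseteq> L" and fin: "kbar.finite_dimension K L"
  obtains xs where "L = kbar.finite_extension K xs"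
proof -
  obtain Us where Us: "kbar.Span K Us = L"
    using fin kbar.exists_base[OF K] by blast
  have incl: "set Us \<subseteq> L" using kbar.Span_base_incl[OF K, of Us] Us by simp
  let ?M = "kbar.finite_extension K Us"
  have "?M \<subseteq> L" by (rule kbar.finite_extension_subring_incl[OF subfieldE(1)[OF L(1)] L(2) incl])
  moreover have "subring ?M kbar" using kbar.finite_extension_is_subring[OF subfieldE(1)[OF K]] by simp
  then have "subalgebra K ?M kbar"
    using subring.axioms(1) subringE(6) kbar.finite_extension_incl[of K Us]
    unfolding subalgebra_def subalgebra_axioms_def by fastforce
  then have "kbar.Span K Us \<subseteq> ?M"
    using kbar.subalgebra_Span_incl[OF K] kbar.finite_extension_mem[OF subfieldE(1)[OF K]] by simp
  ultimately show ?thesis using that Us by blast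
qed

lemma card_extensions:
  fixes L :: "'k::field alg_closure set"
  assumes "perfect_field TYPE('k)" "subfield_hom K s"
    and "subfield L kbar" "K \<subseteq> L" "kbar.finite_dimension K L"
  shows "finite (extensions K L s)" "card (extensions K L s) = kbar.dim K L"
  using finite_dimension_generators[of K L] card_extensions_finite_extension[OF assms(1,2)]
    assms(3-5) subfield_hom.subfield[OF assms(2)] by metis+

lemma dim_pos:
  assumes K: "subfield K kbar" and L: "subfield L kbar" and fin: "kbar.finite_dimension K L"
  shows "kbar.dim K L > 0"
proof (rule ccontr)
  assume "\<not> kbar.dim K L > 0"
  then have "kbar.dimension 0 K L"
    using kbar.finite_dimensionE[OF K fin] by (simp add: over_def)
  then have "L = {0}" using kbar.dimension_zero[OF K] by simp
  then show False using subfield_1[OF L] by simp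
qed

text \<open>The only part of Galois descent needed below: no automorphism of the algebraic closure
  has to be constructed.\<close>

lemma fixed_in_subfield:
  fixes y :: "'k::field alg_closure"
  assumes perfect: "perfect_field TYPE('k)"
    and K: "subfield K kbar" "base_field \<subseteq> K" and M: "subfield M kbar" "K \<subseteq> M"
    and fin: "kbar.finite_dimension K M" and y: "y \<in> M"
    and fixed: "\<And>t. t \<in> extensions K M (\<lambda>x. x) \<Longrightarrow> t y = y"
  shows "y \<in> K"
proof -
  define F where "F = kbar.simple_extension K y"
  note F = simple_extension_facts[OF K, of y, folded F_def]
  have FM: "F \<subseteq> M" unfolding F_def
    by (rule kbar.simple_extension_subring_incl[OF subfieldE(1)[OF M(1)] M(2) y])
  have baseF: "base_field \<subseteq> F" using K(2) F(2) by simp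
  have id: "subfield_hom K (\<lambda>x. x)" using K k_hom_id by (rule subfield_hom.intro)
  \<comment> \<open>Any embedding t of \<open>F\<close> over \<open>K\<close> extends to
    \<open>M\<close>, because the number of extensions is a positive degree. The extended map fixes
    y by assumption, so t fixes y and with it every polynomial in y over \<open>K\<close>; only the
    inclusion remains.\<close>
  have "extensions K F (\<lambda>x. x) \<subseteq> {\<lambda>x\<in>F. x}"
  proof
    fix t assume t: "t \<in> extensions K F (\<lambda>x. x)"
    note tF = subfield_hom_extension[OF F(1) baseF t]
    have finFM: "kbar.finite_dimension F M"
      by (rule finite_dimension_upper[OF K(1) F(1) M(1) F(2) FM fin])
    have "card (extensions F M t) > 0"
      using card_extensions(2)[OF perfect tF M(1) FM finFM] dim_pos[OF F(1) M(1) finFM] by simp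
    then obtain u where u: "u \<in> extensions F M t" by (auto simp: card_gt_0_iff)
    then have "u \<in> extensions K M (\<lambda>x. x)" using t F(2) by (auto simp: extensions_def)
    then have "u y = y" by (rule fixed)
    then have "t y = y" using u F(3) by (simp add: extensions_def)
    interpret t: subfield_hom F t by fact
    have "t z = z" if z: "z \<in> F" for z
    proof -
      obtain p where p: "poly_over K p" "z = poly p y"
        using z by (auto simp: F_def simple_extension_eq[OF K(1)])
      have "map_poly t p = p"
        using t p by (intro poly_eqI) (auto simp: extensions_def poly_over_def)
      then show ?thesis
        using t.poly_map_hom[of p y] p F(2,3) \<open>t y = y\<close>
        by (simp add: poly_over_def subset_iff)
    qed
    then show "t \<in> {\<lambda>x\<in>F. x}"
      using t by (auto simp: extensions_def intro!: extensionalityI[of _ F])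
  qed
  then have "card (extensions K F (\<lambda>x. x)) \<le> card {\<lambda>x\<in>F. x}" by (rule card_mono[rotated]) simp
  then have "kbar.dim K F \<le> 1"
    using card_extensions(2)[OF perfect id F(1,2,4)] by simp
  then have "kbar.dim K F = 1" using dim_pos[OF K(1) F(1,4)] by linarith
  then have dimF: "kbar.dimension 1 K F"
    using kbar.finite_dimensionE[OF K(1) F(4)] by (simp add: over_def)
  \<comment> \<open>In dimension one the single vector 1 spans \<open>F\<close> as well as
    \<open>K\<close>, so the two coincide.\<close>
  have ind: "kbar.independent K [1]" by (rule kbar.li_Cons) auto
  have "kbar.Span K [1] = F" "kbar.Span K [1] = K"
    using kbar.independent_length_eq_dimension[OF K(1) dimF ind]
      kbar.independent_length_eq_dimension[OF K(1) kbar.dimension_one[OF K(1)] ind]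
      subfield_1[OF F(1)] subfield_1[OF K(1)] by auto
  then show ?thesis using F(3) by simp
qed

section \<open>Forms and regular maps\<close>

abbreviation tuple :: "nat \<Rightarrow> (nat \<Rightarrow> 'k::field point \<Rightarrow> 'k alg_closure) \<Rightarrow> 'k point \<Rightarrow> 'k point" where
  "tuple m F v \<equiv> (\<lambda>i. if i \<le> m then F i v else 0)"

text \<open>The source of all equivariance below: closed sets, regular maps and group laws over k
  are built from forms with coefficients that \<open>s\<close> fixes.\<close>

lemma form_hom:
  assumes "subfield_hom L s" "form base_field n d F" "range v \<subseteq> L"
  shows "F v \<in> L" "F (s \<circ> v) = s (F v)"
proof -
  interpret subfield_hom L s by fact
  have "F v \<in> L \<and> F (s \<circ> v) = s (F v)" using assms(2)
    by induction
      (use assms(3) base in \<open>auto simp: hom_base hom_add hom_mult subfield_closed[OF subfield]\<close>)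
  then show "F v \<in> L" "F (s \<circ> v) = s (F v)" by auto
qed

lemma form_scale: "form K n d F \<Longrightarrow> F (\<lambda>i. c * v i) = c ^ d * F v"
  by (induction rule: form.induct) (auto simp: algebra_simps power_add)

lemma form_compose:
  "form K m e G \<Longrightarrow> (\<And>i. i \<le> m \<Longrightarrow> form K n d (F i)) \<Longrightarrow> form K n (e * d) (\<lambda>v. G (tuple m F v))"
proof (induction rule: form.induct)
  case (const c)
  then show ?case using form.const[of c K n] by simp
next
  case (coord i)
  then show ?case by simp
next
  case (add d F G)
  then show ?case using form.add by auto
next
  case (mult d F e G)
  then show ?case using form.mult[OF mult.IH] by (simp add: add_mult_distrib)
qed

lemma normalise_scale: "c \<noteq> 0 \<Longrightarrow> normalise (\<lambda>i. c * v i) = normalise v"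
  by (auto simp: normalise_def)

lemma normalise_eq_scale:
  assumes "v i \<noteq> 0"
  obtains c where "c \<noteq> 0" "normalise v = (\<lambda>i. c * v i)"
proof (rule that)
  have "v (LEAST j. v j \<noteq> 0) \<noteq> 0" using assms by (rule LeastI)
  then show "inverse (v (LEAST j. v j \<noteq> 0)) \<noteq> 0" by simp
  show "normalise v = (\<lambda>i. inverse (v (LEAST j. v j \<noteq> 0)) * v i)"
    by (auto simp: normalise_def divide_inverse mult.commute)
qed

lemma normalise_proj_space:
  assumes "P \<in> proj_space n"
  shows "normalise P = P"
proof -
  obtain i where i: "P i = 1" "\<forall>j<i. P j = 0" using assms by (auto simp: proj_space_def)
  have "(LEAST j. P j \<noteq> 0) = i"
    by (rule Least_equality) (use i in \<open>auto simp: not_le[symmetric]\<close>)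
  then show ?thesis using i by (simp add: normalise_def)
qed

lemma tuple_proj_space: "P \<in> proj_space n \<Longrightarrow> (\<lambda>i. if i \<le> n then P i else 0) = P"
  by (auto simp: proj_space_def)

lemma zariski_closed_proj_space: "zariski_closed K n V \<Longrightarrow> V \<subseteq> proj_space n"
  by (auto simp: zariski_closed_def)

lemma normalise_hom:
  assumes "subfield_hom L s" "range v \<subseteq> L"
  shows "range (normalise v) \<subseteq> L" "normalise (s \<circ> v) = s \<circ> normalise v"
proof -
  interpret subfield_hom L s by fact
  have v: "v i \<in> L" for i using assms(2) by auto
  then have "(LEAST j. s (v j) \<noteq> 0) = (LEAST j. v j \<noteq> 0)" by (simp add: hom_eq_0_iff)
  then show "normalise (s \<circ> v) = s \<circ> normalise v"
    using v by (auto simp: normalise_def hom_divide)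
  show "range (normalise v) \<subseteq> L"
    using v by (auto simp: normalise_def intro: subfield_divide[OF subfield])
qed

text \<open>The equations of \<open>V\<close> have coefficients in k, which \<open>s\<close> fixes;
  as \<open>s\<close> preserves 0 and 1, it also preserves the normal form of coordinates.\<close>

lemma hom_zariski_closed:
  assumes "subfield_hom L s" "zariski_closed base_field n V" "P \<in> V" "range P \<subseteq> L"
  shows "s \<circ> P \<in> V"
proof -
  interpret subfield_hom L s by fact
  obtain S where S: "S \<subseteq> {F. \<exists>d. form base_field n d F}" "V = {P \<in> proj_space n. \<forall>F\<in>S. F P = 0}"
    using assms(2) by (auto simp: zariski_closed_def)
  have "F (s \<circ> P) = 0" if F: "F \<in> S" for F
  proof -
    obtain d where "form base_field n d F" using S(1) F by blast
    then have "F (s \<circ> P) = s (F P)" by (rule form_hom(2)[OF assms(1) _ assms(4)])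
    moreover have "F P = 0" using F assms(3) S(2) by simp
    ultimately show ?thesis by simp
  qed
  moreover have "s \<circ> P \<in> proj_space n"
  proof -
    have "P \<in> proj_space n" using zariski_closed_proj_space[OF assms(2)] assms(3) by blast
    then obtain i where "i \<le> n" "P i = 1" "\<forall>j<i. P j = 0" "\<forall>i>n. P i = 0"
      unfolding proj_space_def by blast
    then show ?thesis unfolding proj_space_def by (intro CollectI conjI exI[of _ i]) simp_all
  qed
  ultimately show ?thesis using S(2) by auto
qed

lemma regular_mapE:
  assumes "regular_map K n V m W f" "P \<in> V"
  obtains d F where "\<And>i. i \<le> m \<Longrightarrow> form K n d (F i)" "\<exists>i\<le>m. F i P \<noteq> 0"
    "\<And>Q. Q \<in> V \<Longrightarrow> \<exists>i\<le>m. F i Q \<noteq> 0 \<Longrightarrow> f Q = normalise (tuple m F Q)"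
proof -
  define local_rep where "local_rep d F \<longleftrightarrow> (\<forall>i\<le>m. form K n d (F i)) \<and> (\<exists>i\<le>m. F i P \<noteq> 0) \<and>
      (\<forall>Q\<in>V. (\<exists>i\<le>m. F i Q \<noteq> 0) \<longrightarrow> f Q = normalise (tuple m F Q))" for d F
  have "\<exists>d F. local_rep d F" using assms unfolding regular_map_def local_rep_def by (elim conjE bspec)
  then obtain d F where F: "local_rep d F" by (elim exE)
  show ?thesis by (rule that[of d F]) (use F in \<open>simp_all add: local_rep_def\<close>)
qed

text \<open>That the conjugate point lies in \<open>V\<close> is assumed rather than deduced from
  closedness, so that the lemma applies directly to the set of Segre points on which the group law
  is given.\<close>

lemma regular_map_hom:
  assumes s: "subfield_hom L s" and f: "regular_map base_field n V m W f"
    and P: "P \<in> V" "s \<circ> P \<in> V" "range P \<subseteq> L"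
  shows "range (f P) \<subseteq> L" "f (s \<circ> P) = s \<circ> f P"
proof -
  interpret subfield_hom L s by fact
  obtain d F where F: "\<And>i. i \<le> m \<Longrightarrow> form base_field n d (F i)" "\<exists>i\<le>m. F i P \<noteq> 0"
    "\<And>Q. Q \<in> V \<Longrightarrow> \<exists>i\<le>m. F i Q \<noteq> 0 \<Longrightarrow> f Q = normalise (tuple m F Q)"
    by (rule regular_mapE[OF f P(1)]) (rule that)
  have FP: "F i P \<in> L \<and> F i (s \<circ> P) = s (F i P)" if "i \<le> m" for i
    using form_hom[OF s F(1)[OF that] P(3)] by simp
  have rng: "range (tuple m F P) \<subseteq> L" using FP subfield_0[OF subfield] by auto
  have fP: "f P = normalise (tuple m F P)" using F P by auto
  then show "range (f P) \<subseteq> L" using normalise_hom[OF s rng] by simp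
  have "\<exists>i\<le>m. F i (s \<circ> P) \<noteq> 0" using F(2) FP hom_eq_0_iff by metis
  then have "f (s \<circ> P) = normalise (tuple m F (s \<circ> P))" using F(3) P(2) by blast
  also have "tuple m F (s \<circ> P) = s \<circ> tuple m F P" using FP by auto
  finally show "f (s \<circ> P) = s \<circ> f P" unfolding fP normalise_hom(2)[OF s rng] .
qed

text \<open>Local forms are substituted into local forms; the scalars introduced by
  \<open>normalise\<close> come out by homogeneity.\<close>

lemma regular_map_compose:
  assumes f: "regular_map K n U m V f" and g: "regular_map K m V l W g"
  shows "regular_map K n U l W (\<lambda>P. g (f P))"
  unfolding regular_map_def
proof (intro conjI ballI)
  show "(\<lambda>P. g (f P)) ` U \<subseteq> W"
    using f g unfolding regular_map_def image_subset_iff by simp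
  fix P assume P: "P \<in> U"
  have fU: "f Q \<in> V" if "Q \<in> U" for Q
    using f that unfolding regular_map_def image_subset_iff by simp
  obtain d F where F: "\<And>i. i \<le> m \<Longrightarrow> form K n d (F i)" "\<exists>i\<le>m. F i P \<noteq> 0"
    "\<And>Q. Q \<in> U \<Longrightarrow> \<exists>i\<le>m. F i Q \<noteq> 0 \<Longrightarrow> f Q = normalise (tuple m F Q)"
    by (rule regular_mapE[OF f P]) (rule that)
  obtain e G where G: "\<And>i. i \<le> l \<Longrightarrow> form K m e (G i)" "\<exists>i\<le>l. G i (f P) \<noteq> 0"
    "\<And>Q. Q \<in> V \<Longrightarrow> \<exists>i\<le>l. G i Q \<noteq> 0 \<Longrightarrow> g Q = normalise (tuple l G Q)"
    by (rule regular_mapE[OF g fU[OF P]]) (rule that)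
  obtain k where k: "k \<le> m" "F k P \<noteq> 0" using F(2) by blast
  \<comment> \<open>If e = 0, the forms \<open>G i \<circ> F\<close> may be nonzero where all \<open>F i\<close> vanish; the factor \<open>F k\<close> repairs this.\<close>
  define H where "H = (\<lambda>j v. G j (tuple m F v) * F k v)"
  \<comment> \<open>The normalising scalar of \<open>f Q\<close> enters every \<open>G j\<close>
    with the same power \<open>e\<close>, so the values of \<open>H\<close> at \<open>Q\<close> and
    of \<open>G\<close> at \<open>f Q\<close> are proportional.\<close>
  have key: "\<exists>c. c \<noteq> 0 \<and> (\<forall>j\<le>l. H j Q = c * G j (f Q))" if Q: "Q \<in> U" "F k Q \<noteq> 0" for Q
  proof -
    have nz: "tuple m F Q k \<noteq> 0" using k Q by simp
    have fQ: "f Q = normalise (tuple m F Q)" using F(3)[OF Q(1)] Q(2) k(1) by blast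
    obtain c where c: "c \<noteq> 0" "f Q = (\<lambda>i. c * tuple m F Q i)"
      unfolding fQ by (rule normalise_eq_scale[of "tuple m F Q", OF nz])
    have "H j Q = F k Q / c ^ e * G j (f Q)" if "j \<le> l" for j
      using form_scale[OF G(1)[OF that], of c "tuple m F Q"] c by (simp add: H_def)
    then show ?thesis using c(1) Q(2) by (intro exI[of _ "F k Q / c ^ e"]) auto
  qed
  show "\<exists>d F. (\<forall>i\<le>l. form K n d (F i)) \<and> (\<exists>i\<le>l. F i P \<noteq> 0) \<and>
    (\<forall>Q\<in>U. (\<exists>i\<le>l. F i Q \<noteq> 0) \<longrightarrow> g (f Q) = normalise (tuple l F Q))"
  proof (rule exI[of _ "e * d + d"], rule exI[of _ H], intro conjI allI impI ballI)
    show "form K n (e * d + d) (H i)" if "i \<le> l" for i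
      unfolding H_def by (intro form.mult form_compose G(1) that F(1) k(1))
    show "\<exists>i\<le>l. H i P \<noteq> 0" using key[OF P k(2)] G(2) by auto
    fix Q assume Q: "Q \<in> U" "\<exists>i\<le>l. H i Q \<noteq> 0"
    then have "F k Q \<noteq> 0" by (auto simp: H_def)
    then obtain c where c: "c \<noteq> 0" "\<And>j. j \<le> l \<Longrightarrow> H j Q = c * G j (f Q)" using key Q(1) by blast
    have "\<exists>i\<le>l. G i (f Q) \<noteq> 0" using Q(2) c by auto
    then have "g (f Q) = normalise (tuple l G (f Q))" by (rule G(3)[OF fU[OF Q(1)]])
    also have "\<dots> = normalise (\<lambda>i. c * tuple l G (f Q) i)" using c(1) by (simp add: normalise_scale)
    also have "(\<lambda>i. c * tuple l G (f Q) i) = tuple l H Q" using c(2) by auto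
    finally show "g (f Q) = normalise (tuple l H Q)" .
  qed
qed

lemma regular_map_const:
  assumes "P \<in> W" "P \<in> proj_space m" "range P \<subseteq> K"
  shows "regular_map K n V m W (\<lambda>_. P)"
proof -
  have nz: "\<exists>i\<le>m. P i \<noteq> 0" using assms(2) by (auto simp: proj_space_def)
  have const: "form K n 0 (\<lambda>_. P i)" for i using assms(3) by (auto intro: form.const)
  show ?thesis
    unfolding regular_map_def
    by (rule conjI, use assms(1) in blast, intro ballI exI[of _ 0] exI[of _ "\<lambda>i _. P i"])
      (simp add: nz const tuple_proj_space[OF assms(2)] normalise_proj_space[OF assms(2)])
qed

section \<open>Residue fields and closed points\<close>

lemma finite_extD:
  assumes "finite_ext L"
  shows "subfield L kbar" "base_field \<subseteq> L" "kbar.finite_dimension base_field L"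
  using assms by (auto simp: finite_ext_def)

lemma finite_ext_over:
  assumes "finite_ext L" "subfield K kbar" "base_field \<subseteq> K" "K \<subseteq> L"
  shows "kbar.finite_dimension K L"
  using finite_dimension_upper[OF subfield_base_field assms(2) _ assms(3,4)] finite_extD[OF assms(1)]
  by blast

lemma finite_ext_finite_extension: "finite_ext (kbar.finite_extension base_field xs)"
  using finite_extension_facts[OF subfield_base_field order.refl, of xs] by (simp add: finite_ext_def)

lemma residue_field_facts:
  shows subfield_residue_field: "subfield (residue_field P) kbar"
    and base_residue_field: "base_field \<subseteq> residue_field P"
    and range_residue_field: "range P \<subseteq> residue_field P"
  unfolding residue_field_def
  using field.generate_fieldE(1,2)[OF field_kbar, of "base_field \<union> range P"] by auto

lemma residue_field_minimal:
  "subfield L kbar \<Longrightarrow> base_field \<subseteq> L \<Longrightarrow> range P \<subseteq> L \<Longrightarrow> residue_field P \<subseteq> L"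
  unfolding residue_field_def
  using field.generate_field_min_subfield1[OF field_kbar, of "base_field \<union> range P" L] by auto

text \<open>Coordinates of index beyond \<open>n\<close> vanish, so finitely many algebraic elements
  generate the residue field.\<close>

lemma finite_ext_residue_field:
  assumes "P \<in> proj_space n"
  shows "finite_ext (residue_field P)"
proof -
  define xs where "xs = map P [0..<Suc n]"
  define M where "M = kbar.finite_extension base_field xs"
  have M: "finite_ext M" unfolding M_def by (rule finite_ext_finite_extension)
  have "set xs \<subseteq> M" unfolding M_def
    by (rule kbar.finite_extension_mem[OF subfieldE(1)[OF subfield_base_field]]) simp
  moreover have "P i \<in> insert 0 (set xs)" for i
    using assms by (cases "i \<le> n") (auto simp: proj_space_def xs_def simp del: upt_Suc)
  ultimately have "range P \<subseteq> M"
    using subfield_0[OF finite_extD(1)[OF M]] unfolding image_subset_iff by (metis insertE subsetD)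
  then have "residue_field P \<subseteq> M"
    using finite_extD[OF M] by (intro residue_field_minimal)
  then have "kbar.finite_dimension base_field (residue_field P)"
    using finite_dimension_lower[OF subfield_base_field subfield_residue_field base_residue_field]
      finite_extD(3)[OF M] by blast
  then show ?thesis
    using subfield_residue_field[of P] base_residue_field[of P] by (simp add: finite_ext_def)
qed

lemma ext_degree_tower:
  assumes "subfield K kbar" "base_field \<subseteq> K" "finite_ext F" "finite_ext L" "K \<subseteq> F" "F \<subseteq> L"
  shows "ext_degree K L = ext_degree K F * ext_degree F L"
  using kbar.telescopic_base_dim(2)[OF assms(1) finite_extD(1)[OF assms(3)]
      finite_ext_over[OF assms(3,1,2,5)] finite_ext_over[OF assms(4) finite_extD(1,2)[OF assms(3)] assms(6)]]
  by (simp add: over_def ext_degree_def)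

text \<open>Both inclusions follow from minimality of residue fields: the elements that
  \<open>s\<close> sends into k(s \<circ> P) form a subfield containing the coordinates of P, and
  the image of k(P) is a subfield containing those of s \<circ> P.\<close>

lemma image_residue_field:
  assumes "subfield_hom L s" "range P \<subseteq> L"
  shows "s ` residue_field P = residue_field (s \<circ> P)"
proof
  interpret subfield_hom L s by fact
  define K where "K = {x \<in> L. s x \<in> residue_field (s \<circ> P)}"
  have "subfield K kbar"
    by (rule subfieldI_kbar)
      (auto simp: K_def hom_add hom_mult hom_uminus hom_inverse subfield_closed[OF subfield]
        subfield_closed[OF subfield_residue_field])
  moreover have "base_field \<subseteq> K"
    using base base_residue_field[of "s \<circ> P"] by (auto simp: K_def hom_base)
  moreover have "range P \<subseteq> K"
    using assms(2) range_residue_field[of "s \<circ> P"] by (auto simp: K_def)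
  ultimately have "residue_field P \<subseteq> K" by (rule residue_field_minimal)
  then show "s ` residue_field P \<subseteq> residue_field (s \<circ> P)" by (auto simp: K_def)
  have "residue_field P \<subseteq> L" using residue_field_minimal[OF subfield base assms(2)] .
  then interpret P: subfield_hom "residue_field P" s
    using subfield_residue_field base_residue_field k_hom_subset[OF hom] by (intro subfield_hom.intro)
  show "residue_field (s \<circ> P) \<subseteq> s ` residue_field P"
    using range_residue_field[of P]
    by (intro residue_field_minimal P.image_subfield P.base_subset_image) auto
qed

section \<open>Galois orbits and their representatives\<close>

lemma galois_group_iff: "\<sigma> \<in> galois_group \<longleftrightarrow> bij \<sigma> \<and> k_hom UNIV \<sigma>"
proof -
  have "1 \<in> (base_field :: 'a alg_closure set)" by (rule subfield_1[OF subfield_base_field])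
  then show ?thesis
    unfolding galois_group_def ring_iso_def ring_hom_def k_hom_def by auto
qed

lemma subfield_hom_galois: "\<sigma> \<in> galois_group \<Longrightarrow> subfield_hom UNIV \<sigma>"
  using kbar.carrier_is_subring field.carrier_is_subfield[OF field_kbar]
  by (intro subfield_hom.intro) (auto simp: galois_group_iff)

lemma galois_id: "id \<in> galois_group"
  by (simp add: galois_group_iff k_hom_def)

lemma galois_comp: "\<sigma> \<in> galois_group \<Longrightarrow> \<tau> \<in> galois_group \<Longrightarrow> \<sigma> \<circ> \<tau> \<in> galois_group"
  by (auto simp: galois_group_iff k_hom_def bij_comp)

lemma galois_inv: "\<sigma> \<in> galois_group \<Longrightarrow> inv_into UNIV \<sigma> \<in> galois_group"
  unfolding galois_group_iff k_hom_def
  by (auto simp: bij_imp_bij_inv bij_is_surj surj_f_inv_f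
      intro!: inv_f_eq bij_is_inj)

definition galois_orbit :: "'k::field point \<Rightarrow> 'k point set" where
  "galois_orbit P = (\<lambda>\<sigma>. \<sigma> \<circ> P) ` galois_group"

lemma closed_points_eq: "closed_points V = galois_orbit ` V"
  by (simp add: closed_points_def galois_orbit_def)

lemma galois_orbit_self: "P \<in> galois_orbit P"
  unfolding galois_orbit_def by (rule image_eqI[OF _ galois_id]) simp

lemma galois_orbit_comp:
  assumes "\<sigma> \<in> galois_group"
  shows "galois_orbit (\<sigma> \<circ> P) = galois_orbit P"
proof -
  have sub: "galois_orbit (\<sigma> \<circ> P) \<subseteq> galois_orbit P" if "\<sigma> \<in> galois_group" for \<sigma> P
    using galois_comp that by (force simp: galois_orbit_def comp_assoc[symmetric])
  have "inv_into UNIV \<sigma> \<circ> (\<sigma> \<circ> P) = P"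
    using assms by (simp add: galois_group_iff bij_is_inj comp_assoc[symmetric])
  then show ?thesis using sub[OF assms] sub[OF galois_inv[OF assms], of "\<sigma> \<circ> P"] by auto
qed

text \<open>\<open>geom_point\<close> is a Hilbert choice, so a representative is known only up to
  an automorphism; every \<sigma> in the later arguments on cycles and symbols comes from
  here.\<close>

lemma geom_point_orbit:
  obtains \<sigma> where "\<sigma> \<in> galois_group" "geom_point (galois_orbit P) = \<sigma> \<circ> P"
proof -
  have "geom_point (galois_orbit P) \<in> galois_orbit P"
    unfolding geom_point_def by (rule someI[of _ P]) (rule galois_orbit_self)
  then show ?thesis using that by (auto simp: galois_orbit_def)
qed

lemma geom_point_closed_point:
  assumes "zariski_closed base_field n V" "x \<in> closed_points V"
  shows "geom_point x \<in> V" "galois_orbit (geom_point x) = x"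
proof -
  obtain P where P: "P \<in> V" "x = galois_orbit P" using assms(2) by (auto simp: closed_points_eq)
  obtain \<sigma> where \<sigma>: "\<sigma> \<in> galois_group" "geom_point x = \<sigma> \<circ> P"
    using geom_point_orbit[of P] P(2) by blast
  show "geom_point x \<in> V"
    using hom_zariski_closed[OF subfield_hom_galois[OF \<sigma>(1)] assms(1) P(1)] \<sigma>(2) by simp
  show "galois_orbit (geom_point x) = x" using galois_orbit_comp \<sigma> P(2) by auto
qed

lemma regular_map_galois:
  assumes "zariski_closed base_field n V" "regular_map base_field n V m W f" "P \<in> V"
    and \<sigma>: "\<sigma> \<in> galois_group"
  shows "\<sigma> \<circ> P \<in> V" "f (\<sigma> \<circ> P) = \<sigma> \<circ> f P"
proof -
  note hom = subfield_hom_galois[OF \<sigma>]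
  show V: "\<sigma> \<circ> P \<in> V" by (rule hom_zariski_closed[OF hom assms(1,3) subset_UNIV])
  show "f (\<sigma> \<circ> P) = \<sigma> \<circ> f P" by (rule regular_map_hom(2)[OF hom assms(2,3) V subset_UNIV])
qed

lemma regular_map_orbit:
  assumes "zariski_closed base_field n V" "regular_map base_field n V m W f" "P \<in> V"
  shows "f ` galois_orbit P = galois_orbit (f P)"
  unfolding galois_orbit_def image_image
  using regular_map_galois(2)[OF assms] by (intro image_cong) auto

lemma range_regular_map:
  assumes "regular_map base_field n V m W f" "P \<in> V" "subfield L kbar" "base_field \<subseteq> L" "range P \<subseteq> L"
  shows "range (f P) \<subseteq> L"
proof -
  have id: "subfield_hom L (\<lambda>x. x)" using assms(3,4) k_hom_id by (rule subfield_hom.intro)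
  have "(\<lambda>x. x) \<circ> P \<in> V" using assms(2) by (simp add: comp_def)
  then show ?thesis using regular_map_hom(1)[OF id assms(1,2) _ assms(5)] by blast
qed

lemma residue_field_regular_map:
  assumes "regular_map base_field n V m W f" "P \<in> V"
  shows "residue_field (f P) \<subseteq> residue_field P"
  using range_regular_map[OF assms subfield_residue_field base_residue_field range_residue_field]
  by (intro residue_field_minimal subfield_residue_field base_residue_field)

text \<open>An injective ring homomorphism carries bases to bases.\<close>

lemma ext_degree_galois:
  assumes \<sigma>: "\<sigma> \<in> galois_group" and K: "subfield K kbar" and fin: "kbar.finite_dimension K L"
  shows "ext_degree (\<sigma> ` K) (\<sigma> ` L) = ext_degree K L"
proof -
  interpret \<sigma>: subfield_hom UNIV \<sigma> by (rule subfield_hom_galois[OF \<sigma>])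
  have "ring_hom_ring kbar kbar \<sigma>"
    using kbar.ring_axioms
    by (intro ring_hom_ringI) (auto simp: \<sigma>.hom_add \<sigma>.hom_mult)
  moreover have "inj_on \<sigma> L" using \<sigma>.hom_inj by (rule inj_on_subset) simp
  ultimately have "kbar.dimension (kbar.dim K L) (\<sigma> ` K) (\<sigma> ` L)"
    using ring_hom_ring.inj_hom_dimension[of kbar kbar \<sigma>, OF _ K]
      kbar.finite_dimensionE[OF K fin] by (simp add: over_def)
  moreover have "subfield (\<sigma> ` K) kbar"
    using ring_hom_ring.img_is_subfield(2)[OF \<open>ring_hom_ring kbar kbar \<sigma>\<close> K] by simp
  ultimately show ?thesis
    using kbar.dimI unfolding ext_degree_def over_def by blast
qed

section \<open>Norms on abelian varieties\<close>

lemma subfield_hom_embedding: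
  assumes "finite_ext L" "s \<in> embeddings L M"
  shows "subfield_hom L s"
  using assms embeddings_iff[of L s M] finite_extD[OF assms(1)] by (intro subfield_hom.intro) auto

lemma segre_hom:
  assumes "subfield_hom L s" "range P \<subseteq> L" "range Q \<subseteq> L"
  shows "range (segre n m P Q) \<subseteq> L" "s \<circ> segre n m P Q = segre n m (s \<circ> P) (s \<circ> Q)"
proof -
  interpret subfield_hom L s by fact
  have "P i \<in> L" "Q i \<in> L" for i using assms by auto
  then show "range (segre n m P Q) \<subseteq> L" "s \<circ> segre n m P Q = segre n m (s \<circ> P) (s \<circ> Q)"
    by (auto simp: segre_def subfield_closed[OF subfield] hom_mult)
qed

context
  fixes A :: "'k::field alg_closure proj_group"
  assumes A: "abelian_variety A"
begin

lemma abelian_variety_comm_group: "comm_group A"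
  and abelian_variety_closed: "zariski_closed base_field (ambient A) (carrier A)"
  and range_one_subset_base: "range \<one>\<^bsub>A\<^esub> \<subseteq> base_field"
  using A by (auto simp: abelian_variety_def)

interpretation comm_group A by (rule abelian_variety_comm_group)

lemma abelian_variety_proj_space: "P \<in> carrier A \<Longrightarrow> P \<in> proj_space (ambient A)"
  using zariski_closed_proj_space[OF abelian_variety_closed] by auto

lemma rational_points_hom:
  assumes "subfield_hom L s" "P \<in> rational_points A L"
  shows "s \<circ> P \<in> carrier A" "range (s \<circ> P) \<subseteq> s ` L"
  using hom_zariski_closed[OF assms(1) abelian_variety_closed, of P] assms(2)
  by (auto simp: rational_points_def)

lemma rational_points_one: "base_field \<subseteq> L \<Longrightarrow> \<one>\<^bsub>A\<^esub> \<in> rational_points A L"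
  using range_one_subset_base by (auto simp: rational_points_def)

lemma hom_one_point:
  assumes "subfield_hom L s"
  shows "s \<circ> \<one>\<^bsub>A\<^esub> = \<one>\<^bsub>A\<^esub>"
proof -
  have "s (\<one>\<^bsub>A\<^esub> i) = \<one>\<^bsub>A\<^esub> i" for i
    using subfield_hom.hom_base[OF assms] range_one_subset_base by auto
  then show ?thesis by (simp add: fun_eq_iff)
qed

text \<open>The group law is a regular map over k on Segre points, and the Segre embedding commutes
  with \<open>s\<close>; products thus inherit rationality and equivariance from
  \<open>regular_map_hom\<close>.\<close>

lemma rational_points_mult:
  assumes s: "subfield_hom L s" and P: "P \<in> rational_points A L" "Q \<in> rational_points A L"
  shows "P \<otimes>\<^bsub>A\<^esub> Q \<in> rational_points A L"
    and "s \<circ> (P \<otimes>\<^bsub>A\<^esub> Q) = (s \<circ> P) \<otimes>\<^bsub>A\<^esub> (s \<circ> Q)"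
proof -
  let ?n = "ambient A"
  let ?V = "{segre ?n ?n P Q | P Q. P \<in> carrier A \<and> Q \<in> carrier A}"
  obtain \<mu> where \<mu>: "regular_map base_field ((?n + 1) * (?n + 1) - 1) ?V ?n (carrier A) \<mu>"
    "\<And>P Q. P \<in> carrier A \<Longrightarrow> Q \<in> carrier A \<Longrightarrow> \<mu> (segre ?n ?n P Q) = P \<otimes>\<^bsub>A\<^esub> Q"
    using A unfolding abelian_variety_def by blast
  have carr: "P \<in> carrier A" "Q \<in> carrier A" and rng: "range P \<subseteq> L" "range Q \<subseteq> L"
    using P by (auto simp: rational_points_def)
  note sP = rational_points_hom(1)[OF s P(1)] and sQ = rational_points_hom(1)[OF s P(2)]
  note seg = segre_hom[OF s rng, of ?n ?n]
  have V: "segre ?n ?n P Q \<in> ?V" using carr by blast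
  have "segre ?n ?n (s \<circ> P) (s \<circ> Q) \<in> ?V" using sP sQ by blast
  then have sV: "s \<circ> segre ?n ?n P Q \<in> ?V" by (simp only: seg(2))
  note \<mu>hom = regular_map_hom[OF s \<mu>(1) V sV seg(1)]
  show "P \<otimes>\<^bsub>A\<^esub> Q \<in> rational_points A L"
    using \<mu>hom(1) \<mu>(2)[OF carr] carr by (simp add: rational_points_def)
  show "s \<circ> (P \<otimes>\<^bsub>A\<^esub> Q) = (s \<circ> P) \<otimes>\<^bsub>A\<^esub> (s \<circ> Q)"
    using \<mu>hom(2) \<mu>(2)[OF carr] \<mu>(2)[OF sP sQ] by (simp only: seg(2))
qed

lemma rational_points_pow:
  assumes s: "subfield_hom L s" and P: "P \<in> rational_points A L"
  shows "P [^]\<^bsub>A\<^esub> (n::nat) \<in> rational_points A L"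
  using rational_points_mult(1)[OF s _ P] rational_points_one[OF subfield_hom.base[OF s]]
  by (induction n) auto

lemma rational_points_finprod:
  assumes s: "subfield_hom L s" and f: "\<And>i. i \<in> I \<Longrightarrow> f i \<in> rational_points A L" and I: "finite I"
  shows "finprod A f I \<in> rational_points A L \<and> s \<circ> finprod A f I = finprod A (\<lambda>i. s \<circ> f i) I"
  using I f
proof (induction I)
  case empty
  then show ?case
    using rational_points_one[OF subfield_hom.base[OF s]] hom_one_point[OF s] by simp
next
  case (insert i I)
  have "f \<in> I \<rightarrow> carrier A" "f i \<in> carrier A"
    using insert.prems by (auto simp: rational_points_def)
  moreover have "(\<lambda>i. s \<circ> f i) \<in> I \<rightarrow> carrier A" "s \<circ> f i \<in> carrier A"
    using insert.prems rational_points_hom(1)[OF s] by auto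
  moreover have IH: "finprod A f I \<in> rational_points A L"
      "s \<circ> finprod A f I = finprod A (\<lambda>i. s \<circ> f i) I"
    using insert.IH insert.prems by blast+
  moreover have "f i \<in> rational_points A L" using insert.prems by blast
  ultimately show ?case
    using rational_points_mult[OF s, of "f i" "finprod A f I"]
    by (simp only: finprod_insert[OF insert.hyps] simp_thms)
qed

end

text \<open>Once \<open>\<tau>\<close> is inverted on its image, the members of \<open>S\<close> are
  the extensions of this inverse to \<open>L\<close>, and these have already been counted.\<close>

lemma norm_index_set:
  fixes K L :: "'k::field alg_closure set"
  assumes perfect: "perfect_field TYPE('k)" and K: "finite_ext K" and L: "finite_ext L"
    and \<tau>: "\<tau> \<in> embeddings K L"
  defines "S \<equiv> {s \<in> embeddings L UNIV. \<forall>c\<in>K. s (\<tau> c) = c}"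
  shows "finite S" "card S = ext_degree (\<tau> ` K) L"
proof -
  interpret \<tau>: subfield_hom K \<tau> by (rule subfield_hom_embedding[OF K \<tau>])
  have sub: "\<tau> ` K \<subseteq> L" using \<tau> embeddings_iff[OF \<tau>.base \<tau>.subfield] by blast
  define \<rho> where "\<rho> = inv_into K \<tau>"
  have \<rho>: "\<rho> (\<tau> a) = a" if "a \<in> K" for a
    using that \<tau>.hom_inj by (simp add: \<rho>_def inv_into_f_f)
  have "k_hom (\<tau> ` K) \<rho>"
    unfolding k_hom_def
  proof (intro conjI ballI)
    fix x y assume "x \<in> \<tau> ` K" "y \<in> \<tau> ` K"
    then obtain a b where ab: "a \<in> K" "b \<in> K" "x = \<tau> a" "y = \<tau> b" by blast
    then show "\<rho> (x + y) = \<rho> x + \<rho> y" "\<rho> (x * y) = \<rho> x * \<rho> y"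
      by (simp_all add: \<rho> subfield_closed[OF \<tau>.subfield] flip: \<tau>.hom_add \<tau>.hom_mult)
  next
    fix c :: "'k alg_closure" assume "c \<in> base_field"
    then show "\<rho> c = c" using \<rho>[of c] \<tau>.hom_base[of c] \<tau>.base by auto
  qed
  then have hom: "subfield_hom (\<tau> ` K) \<rho>"
    using \<tau>.image_subfield \<tau>.base_subset_image by (intro subfield_hom.intro)
  have "S = extensions (\<tau> ` K) L \<rho>"
    unfolding S_def extensions_def
    using embeddings_iff[OF finite_extD(2,1)[OF L], of _ UNIV] \<rho> by auto
  then show "finite S" "card S = ext_degree (\<tau> ` K) L"
    using card_extensions[OF perfect hom finite_extD(1)[OF L] sub
        finite_ext_over[OF L \<tau>.image_subfield \<tau>.base_subset_image sub]]
    by (simp_all add: ext_degree_def)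
qed

text \<open>All conjugates of \<open>a\<close> live over one finite extension \<open>M\<close>, and
  an embedding of \<open>M\<close> over \<open>K\<close> merely permutes the factors of the norm;
  \<open>fixed_in_subfield\<close> then places the coordinates in \<open>K\<close>. This keeps the
  projection relations among genuine symbols.\<close>

lemma norm_map_rational:
  fixes A :: "'k::field alg_closure proj_group"
  assumes perfect: "perfect_field TYPE('k)" and A: "abelian_variety A"
    and K: "finite_ext K" and L: "finite_ext L" and \<tau>: "\<tau> \<in> embeddings K L"
    and a: "a \<in> rational_points A L"
  shows "norm_map A \<tau> K L a \<in> rational_points A K"
proof -
  interpret comm_group A by (rule abelian_variety_comm_group[OF A])
  interpret \<tau>: subfield_hom K \<tau> by (rule subfield_hom_embedding[OF K \<tau>])
  define S where "S = {s \<in> embeddings L UNIV. \<forall>c\<in>K. s (\<tau> c) = c}"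
  note S = norm_index_set[OF perfect K L \<tau>, folded S_def]
  have homS: "subfield_hom L s" if "s \<in> S" for s
    using subfield_hom_embedding[OF L] that by (auto simp: S_def)
  define N where "N = finprod A (\<lambda>s. s \<circ> a) S"
  obtain xs where xs: "L = kbar.finite_extension base_field xs"
    using finite_dimension_generators[OF subfield_base_field finite_extD[OF L]] .
  obtain ys where ys: "K = kbar.finite_extension base_field ys"
    using finite_dimension_generators[OF subfield_base_field finite_extD[OF K]] .
  have mem: "set zs \<subseteq> kbar.finite_extension base_field zs" for zs :: "'k alg_closure list"
    by (rule kbar.finite_extension_mem[OF subfieldE(1)[OF subfield_base_field]]) simp
  \<comment> \<open>Generators of \<open>K\<close> and all images of generators of \<open>L\<close>:
    adjoining them to k gives a finite extension that contains \<open>K\<close> and every conjugate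
    of \<open>L\<close>.\<close>
  have "finite (set ys \<union> (\<Union>s\<in>S. s ` set xs))" using S(1) by simp
  then obtain zs where zs: "set zs = set ys \<union> (\<Union>s\<in>S. s ` set xs)"
    using finite_list by blast
  define M where "M = kbar.finite_extension base_field zs"
  have M: "finite_ext M" unfolding M_def by (rule finite_ext_finite_extension)
  note MD = finite_extD[OF M]
  have zsM: "set zs \<subseteq> M" unfolding M_def by (rule mem)
  have "set ys \<subseteq> M" using zs zsM by blast
  then have KM: "K \<subseteq> M"
    using kbar.finite_extension_subring_incl[OF subfieldE(1)[OF MD(1)] MD(2), of ys] ys by blast
  have SM: "s ` L \<subseteq> M" if s: "s \<in> S" for s
  proof -
    interpret s: subfield_hom L s by (rule homS[OF s])
    \<comment> \<open>The elements of \<open>L\<close> that s sends into \<open>M\<close> form a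
      subfield; as it contains k and the generators of \<open>L\<close>, it is all of
      \<open>L\<close>.\<close>
    define L' where "L' = {x \<in> L. s x \<in> M}"
    have "subfield L' kbar"
      by (rule subfieldI_kbar)
        (auto simp: L'_def s.hom_add s.hom_mult s.hom_uminus s.hom_inverse
          subfield_closed[OF s.subfield] subfield_closed[OF MD(1)])
    moreover have "base_field \<subseteq> L'" using s.base MD(2) by (auto simp: L'_def s.hom_base)
    moreover have "set xs \<subseteq> L'"
    proof
      fix x assume x: "x \<in> set xs"
      then have "s x \<in> set zs" using zs s by blast
      moreover have "x \<in> L" using x mem[of xs] xs by blast
      ultimately show "x \<in> L'" using zsM by (auto simp: L'_def)
    qed
    ultimately have "L \<subseteq> L'"
      using kbar.finite_extension_subring_incl[OF subfieldE(1), of L' base_field xs] xs by blast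
    then show ?thesis by (auto simp: L'_def)
  qed
  have sa: "s \<circ> a \<in> rational_points A M" if "s \<in> S" for s
    using rational_points_hom[OF A homS[OF that] a] SM[OF that] by (auto simp: rational_points_def)
  have NM: "N \<in> rational_points A M"
    using rational_points_finprod[OF A subfield_hom.intro[OF MD(1,2) k_hom_id], of S "\<lambda>s. s \<circ> a"] sa S(1)
    by (simp add: N_def)
  have fixed: "\<rho> \<circ> N = N" if \<rho>: "\<rho> \<in> extensions K M (\<lambda>x. x)" for \<rho>
  proof -
    interpret \<rho>: subfield_hom M \<rho> by (rule subfield_hom_extension[OF MD(1,2) \<rho>])
    \<comment> \<open>Postcomposition with \<open>\<rho>\<close> maps the finite set
      \<open>S\<close> injectively into itself, so it permutes \<open>S\<close> and with it the
      factors of the product.\<close>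
    define h where "h s = restrict (\<rho> \<circ> s) L" for s
    have hS: "h s \<in> S" if s: "s \<in> S" for s
    proof -
      interpret s: subfield_hom L s by (rule homS[OF s])
      have "k_hom L (\<lambda>x. \<rho> (s x))" by (rule k_hom_comp[OF s.hom \<rho>.hom SM[OF s]])
      then have "k_hom L (h s)" using k_hom_cong[OF s.base s.subfield, of "h s"] by (simp add: h_def)
      moreover have "h s (\<tau> c) = c" if c: "c \<in> K" for c
      proof -
        have "\<tau> c \<in> L" using \<tau> c embeddings_iff[OF \<tau>.base \<tau>.subfield] by blast
        then show ?thesis using s \<rho> c by (simp add: h_def S_def extensions_def)
      qed
      ultimately show ?thesis
        using embeddings_iff[OF s.base s.subfield] by (simp add: S_def h_def)
    qed
    have inj: "inj_on h S"
    proof (rule inj_onI)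
      fix s t assume st: "s \<in> S" "t \<in> S" "h s = h t"
      show "s = t"
      proof (rule extensionalityI[of _ L])
        fix x assume x: "x \<in> L"
        then have "\<rho> (s x) = \<rho> (t x)" using fun_cong[OF st(3), of x] by (simp add: h_def)
        moreover have "s x \<in> M" "t x \<in> M" using SM[OF st(1)] SM[OF st(2)] x by blast+
        ultimately show "s x = t x" by (rule inj_onD[OF \<rho>.hom_inj])
      qed (use st in \<open>auto simp: S_def embeddings_def\<close>)
    qed
    have "h ` S = S" using hS inj S(1) by (simp add: endo_inj_surj image_subset_iff)
    have ha: "h s \<circ> a = \<rho> \<circ> (s \<circ> a)" for s
    proof
      fix i
      have "a i \<in> L" using a by (auto simp: rational_points_def)
      then show "(h s \<circ> a) i = (\<rho> \<circ> (s \<circ> a)) i" by (simp add: h_def)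
    qed
    have "\<rho> \<circ> N = finprod A (\<lambda>s. \<rho> \<circ> (s \<circ> a)) S"
      using rational_points_finprod[OF A \<rho>.subfield_hom_axioms, of S "\<lambda>s. s \<circ> a"] sa S(1) by (simp add: N_def)
    also have "\<dots> = finprod A (\<lambda>s. h s \<circ> a) S" by (simp add: ha)
    also have "\<dots> = finprod A (\<lambda>s. s \<circ> a) (h ` S)"
    proof (rule finprod_reindex[symmetric, OF _ inj], unfold \<open>h ` S = S\<close>, rule Pi_I)
      show "s \<circ> a \<in> carrier A" if "s \<in> S" for s
        using sa[OF that] unfolding rational_points_def by blast
    qed
    finally show ?thesis by (simp add: \<open>h ` S = S\<close> N_def)
  qed
  have "N i \<in> K" for i
  proof (rule fixed_in_subfield[OF perfect finite_extD(1,2)[OF K] MD(1) KM])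
    show "kbar.finite_dimension K M" by (rule finite_ext_over[OF M finite_extD(1,2)[OF K] KM])
    show "N i \<in> M" using NM by (auto simp: rational_points_def)
    show "t (N i) = N i" if "t \<in> extensions K M (\<lambda>x. x)" for t
      using fun_cong[OF fixed[OF that], of i] by simp
  qed
  moreover have "N = norm_map A \<tau> K L a" by (simp add: N_def S_def norm_map_def)
  ultimately show ?thesis using NM by (auto simp: rational_points_def)
qed

text \<open>On a point coming from \<open>K\<close> all factors of the norm coincide, since s
  \<circ> \<tau> is the identity on \<open>K\<close> for every s in the index set.\<close>

lemma norm_map_restrict:
  fixes A :: "'k::field alg_closure proj_group"
  assumes perfect: "perfect_field TYPE('k)" and A: "abelian_variety A"
    and K: "finite_ext K" and L: "finite_ext L" and \<tau>: "\<tau> \<in> embeddings K L"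
    and a: "a \<in> rational_points A K"
  shows "norm_map A \<tau> K L (\<tau> \<circ> a) = a [^]\<^bsub>A\<^esub> ext_degree (\<tau> ` K) L"
proof -
  interpret comm_group A by (rule abelian_variety_comm_group[OF A])
  define S where "S = {s \<in> embeddings L UNIV. \<forall>c\<in>K. s (\<tau> c) = c}"
  have carr: "a \<in> carrier A" and rng: "\<And>i. a i \<in> K" using a by (auto simp: rational_points_def)
  have "finprod A (\<lambda>s. s \<circ> (\<tau> \<circ> a)) S = finprod A (\<lambda>s. a) S"
    by (rule finprod_cong') (use carr rng in \<open>auto simp: S_def fun_eq_iff\<close>)
  also have "\<dots> = a [^]\<^bsub>A\<^esub> card S" using carr by (simp add: finprod_const)
  finally show ?thesis
    using norm_index_set(2)[OF perfect K L \<tau>] by (simp add: norm_map_def S_def)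
qed

lemma hom_finprod_comm_group:
  assumes "comm_group G" "comm_group H" "h \<in> hom G H" "f \<in> I \<rightarrow> carrier G"
  shows "h (finprod G f I) = finprod H (\<lambda>i. h (f i)) I"
  using assms(4)
proof (induction I rule: infinite_finite_induct)
  interpret G: comm_group G by fact
  interpret H: comm_group H by fact
  have one: "h \<one>\<^bsub>G\<^esub> = \<one>\<^bsub>H\<^esub>"
    by (rule hom_one[OF assms(3)]) (simp_all add: G.is_group H.is_group)
  \<comment> \<open>A product over an infinite set is the unit by convention, on both sides.\<close>
  case (infinite I)
  then show ?case by (simp add: G.finprod_infinite H.finprod_infinite one)
next
  interpret G: comm_group G by fact
  interpret H: comm_group H by fact
  have one: "h \<one>\<^bsub>G\<^esub> = \<one>\<^bsub>H\<^esub>"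
    by (rule hom_one[OF assms(3)]) (simp_all add: G.is_group H.is_group)
  case empty
  then show ?case by (simp add: one)
next
  interpret G: comm_group G by fact
  interpret H: comm_group H by fact
  case (insert i I)
  have "(\<lambda>i. h (f i)) \<in> I \<rightarrow> carrier H" "h (f i) \<in> carrier H"
    using insert.prems hom_in_carrier[OF assms(3)] by auto
  then show ?case
    using insert hom_mult[OF assms(3), of "f i" "finprod G f I"] by (auto simp: Pi_iff)
qed

text \<open>\<open>\<phi>\<close> distributes over the product as a group homomorphism and commutes
  with each embedding as a regular map over k.\<close>

lemma norm_map_hom:
  assumes A: "abelian_variety A" and B: "abelian_variety B"
    and \<phi>: "regular_map base_field (ambient A) (carrier A) (ambient B) (carrier B) \<phi>"
      "\<phi> \<in> hom A B"
    and L: "finite_ext L" and a: "a \<in> rational_points A L"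
  shows "\<phi> (norm_map A \<tau> K L a) = norm_map B \<tau> K L (\<phi> a)"
proof -
  interpret B: comm_group B by (rule abelian_variety_comm_group[OF B])
  define S where "S = {s \<in> embeddings L UNIV. \<forall>c\<in>K. s (\<tau> c) = c}"
  have sa: "s \<circ> a \<in> carrier A" "\<phi> (s \<circ> a) = s \<circ> \<phi> a" if "s \<in> S" for s
  proof -
    have s: "subfield_hom L s" using subfield_hom_embedding[OF L] that by (auto simp: S_def)
    show *: "s \<circ> a \<in> carrier A" by (rule rational_points_hom(1)[OF A s a])
    show "\<phi> (s \<circ> a) = s \<circ> \<phi> a"
      using a by (intro regular_map_hom(2)[OF s \<phi>(1) _ *]) (auto simp: rational_points_def)
  qed
  have "\<phi> (finprod A (\<lambda>s. s \<circ> a) S) = finprod B (\<lambda>s. \<phi> (s \<circ> a)) S"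
    using sa(1) hom_finprod_comm_group[OF abelian_variety_comm_group[OF A]
        abelian_variety_comm_group[OF B] \<phi>(2), of "\<lambda>s. s \<circ> a" S] by (simp add: Pi_iff)
  also have "\<dots> = finprod B (\<lambda>s. s \<circ> \<phi> a) S"
    using sa hom_in_carrier[OF \<phi>(2)] by (intro B.finprod_cong') (auto, metis)
  finally show ?thesis by (simp add: norm_map_def S_def)
qed

section \<open>Subgroups of free abelian groups\<close>

context
  fixes S :: "'a set" and R :: "('a \<Rightarrow>\<^sub>0 int) set"
  assumes R: "R \<subseteq> {c. Poly_Mapping.keys c \<subseteq> S}"
begin

lemma generate_frag_subgroup: "subgroup (generate (free_Abelian_group S) R) (free_Abelian_group S)"
  by (rule group.generate_is_subgroup[OF group_free_Abelian_group]) (use R in auto)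

lemma generate_frag_keys: "a \<in> generate (free_Abelian_group S) R \<Longrightarrow> Poly_Mapping.keys a \<subseteq> S"
  using subgroup.mem_carrier[OF generate_frag_subgroup] by simp

lemma generate_frag_0: "0 \<in> generate (free_Abelian_group S) R"
  using subgroup.one_closed[OF generate_frag_subgroup] by simp

lemma generate_frag_add:
  "a \<in> generate (free_Abelian_group S) R \<Longrightarrow> b \<in> generate (free_Abelian_group S) R \<Longrightarrow>
    a + b \<in> generate (free_Abelian_group S) R"
  using subgroup.m_closed[OF generate_frag_subgroup] by simp

lemma generate_frag_uminus:
  "a \<in> generate (free_Abelian_group S) R \<Longrightarrow> - a \<in> generate (free_Abelian_group S) R"
  using subgroup.m_inv_closed[OF generate_frag_subgroup, of a] generate_frag_keys[of a] by simp

lemma generate_frag_diff: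
  "a \<in> generate (free_Abelian_group S) R \<Longrightarrow> b \<in> generate (free_Abelian_group S) R \<Longrightarrow>
    a - b \<in> generate (free_Abelian_group S) R"
  using generate_frag_add[of a "- b"] generate_frag_uminus[of b] by simp

text \<open>The group inverse is negation only on elements supported on \<open>S\<close>; the
  assumption on \<open>R\<close> makes this purely additive form of the induction possible.\<close>

lemma generate_frag_induct [consumes 1, case_names zero gen add uminus]:
  assumes "a \<in> generate (free_Abelian_group S) R"
    and "P 0" "\<And>a. a \<in> R \<Longrightarrow> P a" "\<And>a b. P a \<Longrightarrow> P b \<Longrightarrow> P (a + b)" "\<And>a. P a \<Longrightarrow> P (- a)"
  shows "P a"
  using assms(1)
proof (induction rule: generate.induct)
  case (inv h)
  then have "Poly_Mapping.keys h \<subseteq> S" using R by blast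
  then show ?case using assms(3,5) inv by simp
qed (use assms in auto)

lemma generate_frag_coset_eq:
  "Poly_Mapping.keys z \<subseteq> S \<Longrightarrow>
    generate (free_Abelian_group S) R #>\<^bsub>free_Abelian_group S\<^esub> z = generate (free_Abelian_group S) R \<longleftrightarrow>
    z \<in> generate (free_Abelian_group S) R"
  using group.coset_join1[OF group_free_Abelian_group _ _ generate_frag_subgroup]
    group.coset_join2[OF group_free_Abelian_group _ generate_frag_subgroup] by auto

lemma generate_frag_coset_cong:
  assumes "Poly_Mapping.keys z \<subseteq> S" "h \<in> generate (free_Abelian_group S) R"
  shows "generate (free_Abelian_group S) R #>\<^bsub>free_Abelian_group S\<^esub> (h + z) =
    generate (free_Abelian_group S) R #>\<^bsub>free_Abelian_group S\<^esub> z"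
proof (rule group.repr_independence[OF group_free_Abelian_group _ _ generate_frag_subgroup, symmetric])
  show "h + z \<in> generate (free_Abelian_group S) R #>\<^bsub>free_Abelian_group S\<^esub> z"
    using assms(2) by (auto simp: r_coset_def)
qed (use assms in auto)

end

text \<open>A homomorphism of free groups respects subgroups of relations once it does so on
  generators. Push-forward of cycles, \<open>Phi\<close> and the map between symmetric K-groups all
  descend to quotients by this.\<close>

lemma generate_frag_extend:
  assumes R: "R \<subseteq> {c. Poly_Mapping.keys c \<subseteq> S}" and R': "R' \<subseteq> {c. Poly_Mapping.keys c \<subseteq> S'}"
    and f: "\<And>a. a \<in> R \<Longrightarrow> frag_extend f a \<in> generate (free_Abelian_group S') R'"
    and a: "a \<in> generate (free_Abelian_group S) R"
  shows "frag_extend f a \<in> generate (free_Abelian_group S') R'"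
  using a
  by (induction rule: generate_frag_induct[OF R, consumes 1])
    (auto simp: frag_extend_add frag_extend_minus f
      intro: generate_frag_0[OF R'] generate_frag_add[OF R'] generate_frag_uminus[OF R'])

text \<open>Maps on cosets are defined by \<open>the_elem\<close> of an image, so independence of
  the representative amounts to the image being a singleton.\<close>

lemma the_elem_coset_image:
  assumes "\<And>h. h \<in> H \<Longrightarrow> f (h + z) = w" "H \<noteq> {}"
  shows "the_elem (f ` (H #>\<^bsub>free_Abelian_group S\<^esub> z)) = w"
proof -
  have "f ` (H #>\<^bsub>free_Abelian_group S\<^esub> z) = {w}"
    using assms by (auto simp: r_coset_def)
  then show ?thesis by simp
qed

section \<open>Push-forward of zero-cycles\<close>

lemma keys_principal_divisor: "Poly_Mapping.keys (principal_divisor n C e F G) \<subseteq> closed_points C"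
  unfolding principal_divisor_def
  by (rule order_trans[OF keys_sum]) (auto dest: subsetD[OF keys_cmul])

lemma cycle_push_keys:
  assumes V: "zariski_closed base_field n V" and f: "regular_map base_field n V m W f"
    and z: "Poly_Mapping.keys z \<subseteq> closed_points V"
  shows "Poly_Mapping.keys (cycle_push f z) \<subseteq> closed_points W"
proof -
  have "f ` x \<in> closed_points W" if x: "x \<in> closed_points V" for x
  proof -
    note g = geom_point_closed_point[OF V x]
    have "f (geom_point x) \<in> W" using f g(1) unfolding regular_map_def by blast
    then show ?thesis
      using regular_map_orbit[OF V f g(1)] g(2) by (auto simp: closed_points_eq)
  qed
  then show ?thesis
    using z unfolding cycle_push_def
    by (intro order_trans[OF keys_frag_extend]) (auto dest!: subsetD[OF keys_cmul])
qed

lemma geom_point_image: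
  assumes V: "zariski_closed base_field n V" and f: "regular_map base_field n V m W f"
    and x: "x \<in> closed_points V"
  obtains \<sigma> where "\<sigma> \<in> galois_group" "geom_point (f ` x) = \<sigma> \<circ> f (geom_point x)"
proof -
  note g = geom_point_closed_point[OF V x]
  have "f ` x = galois_orbit (f (geom_point x))"
    using regular_map_orbit[OF V f g(1)] g(2) by simp
  then show ?thesis using geom_point_orbit[of "f (geom_point x)"] that by auto
qed

lemma image_residue_field_galois:
  "\<sigma> \<in> galois_group \<Longrightarrow> \<sigma> ` residue_field P = residue_field (\<sigma> \<circ> P)"
  by (rule image_residue_field[OF subfield_hom_galois]) auto

text \<open>Residue degrees multiply in towers. The point chosen in the image orbit is only a
  conjugate of \<open>f P\<close>, so one of the two degrees has first to be moved back by
  \<open>ext_degree_galois\<close>.\<close>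

lemma cycle_push_compose:
  assumes U: "zariski_closed base_field n U" and V: "zariski_closed base_field m V"
    and f: "regular_map base_field n U m V f" and g: "regular_map base_field m V l W g"
    and z: "Poly_Mapping.keys z \<subseteq> closed_points U"
  shows "cycle_push g (cycle_push f z) = cycle_push (\<lambda>P. g (f P)) z"
  using z
proof (induction z rule: frag_induction)
  case zero
  show ?case by (simp add: cycle_push_def)
next
  case (one x)
  define P where "P = geom_point x"
  have P: "P \<in> U" unfolding P_def by (rule geom_point_closed_point(1)[OF U one])
  have fP: "f P \<in> V" using f P unfolding regular_map_def by blast
  obtain \<sigma> where \<sigma>: "\<sigma> \<in> galois_group" "geom_point (f ` x) = \<sigma> \<circ> f P"
    using geom_point_image[OF U f one] unfolding P_def .
  have fin: "finite_ext (residue_field P)" "finite_ext (residue_field (f P))"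
    using zariski_closed_proj_space[OF U] zariski_closed_proj_space[OF V] P fP
    by (auto intro: finite_ext_residue_field)
  note sub = residue_field_regular_map[OF f P] residue_field_regular_map[OF g fP]
  have "g (\<sigma> \<circ> f P) = \<sigma> \<circ> g (f P)" by (rule regular_map_galois(2)[OF V g fP \<sigma>(1)])
  then have "ext_degree (residue_field (g (geom_point (f ` x)))) (residue_field (geom_point (f ` x))) =
      ext_degree (\<sigma> ` residue_field (g (f P))) (\<sigma> ` residue_field (f P))"
    using \<sigma> by (simp only: image_residue_field_galois)
  also have "\<dots> = ext_degree (residue_field (g (f P))) (residue_field (f P))"
    by (intro ext_degree_galois \<sigma>(1) subfield_residue_field
        finite_ext_over[OF fin(2) subfield_residue_field base_residue_field sub(2)])
  finally have "int (ext_degree (residue_field (f P)) (residue_field P)) *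
      int (ext_degree (residue_field (g (geom_point (f ` x)))) (residue_field (geom_point (f ` x)))) =
      int (ext_degree (residue_field (g (f P))) (residue_field P))"
    using ext_degree_tower[OF subfield_residue_field base_residue_field fin(2,1) sub(2,1)] by simp
  then show ?case
    by (simp add: cycle_push_def frag_extend_cmul image_image P_def)
next
  case (diff a b)
  then show ?case by (simp add: cycle_push_def frag_extend_diff)
qed

text \<open>The degree is push-forward to a point: a homomorphism into the free group on one
  generator, from which its linearity is inherited.\<close>

lemma cycle_degree_eq:
  "cycle_degree z = Poly_Mapping.lookup
     (frag_extend (\<lambda>x. frag_cmul (int (ext_degree base_field (residue_field (geom_point x)))) (frag_of ())) z) ()"
  by (simp add: cycle_degree_def frag_extend_def lookup_sum)

lemma cycle_degree_add: "cycle_degree (a + b) = cycle_degree a + cycle_degree b"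
  and cycle_degree_diff: "cycle_degree (a - b) = cycle_degree a - cycle_degree b"
  and cycle_degree_uminus: "cycle_degree (- a) = - cycle_degree a"
  and cycle_degree_0: "cycle_degree 0 = 0"
  and cycle_degree_cmul: "cycle_degree (frag_cmul n a) = n * cycle_degree a"
  and cycle_degree_of: "cycle_degree (frag_of x) = int (ext_degree base_field (residue_field (geom_point x)))"
  by (simp_all add: cycle_degree_eq frag_extend_add frag_extend_diff frag_extend_minus
      frag_extend_cmul lookup_add lookup_minus)

text \<open>The tower law over k; replacing a representative by a conjugate leaves k, hence the
  degree over k, unchanged.\<close>

lemma cycle_degree_push:
  assumes V: "zariski_closed base_field n V" and W: "W \<subseteq> proj_space m"
    and f: "regular_map base_field n V m W f"
    and z: "Poly_Mapping.keys z \<subseteq> closed_points V"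
  shows "cycle_degree (cycle_push f z) = cycle_degree z"
  using z
proof (induction z rule: frag_induction)
  case zero
  show ?case by (simp add: cycle_push_def cycle_degree_0)
next
  case (one x)
  define P where "P = geom_point x"
  have P: "P \<in> V" unfolding P_def by (rule geom_point_closed_point(1)[OF V one])
  have fP: "f P \<in> W" using f P unfolding regular_map_def by blast
  obtain \<sigma> where \<sigma>: "\<sigma> \<in> galois_group" "geom_point (f ` x) = \<sigma> \<circ> f P"
    using geom_point_image[OF V f one] unfolding P_def .
  interpret \<sigma>: subfield_hom UNIV \<sigma> by (rule subfield_hom_galois[OF \<sigma>(1)])
  have fin: "finite_ext (residue_field P)" "finite_ext (residue_field (f P))"
    using zariski_closed_proj_space[OF V] W P fP by (auto intro: finite_ext_residue_field)
  have "\<sigma> ` base_field = base_field" using \<sigma>.hom_base by simp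
  then have "ext_degree base_field (residue_field (geom_point (f ` x))) =
      ext_degree (\<sigma> ` base_field) (\<sigma> ` residue_field (f P))"
    using \<sigma> by (simp only: image_residue_field_galois)
  also have "\<dots> = ext_degree base_field (residue_field (f P))"
    by (intro ext_degree_galois \<sigma>(1) subfield_base_field finite_extD(3)[OF fin(2)])
  finally show ?case
    using ext_degree_tower[OF subfield_base_field order.refl fin(2,1) base_residue_field
        residue_field_regular_map[OF f P]]
    by (simp add: cycle_push_def cycle_degree_cmul cycle_degree_of P_def)
next
  case (diff a b)
  then show ?case by (simp add: cycle_push_def frag_extend_diff cycle_degree_diff)
qed

section \<open>Rational equivalence under push-forward\<close>

definition rat_generators :: "nat \<Rightarrow> 'k::field point set \<Rightarrow> ('k point set \<Rightarrow>\<^sub>0 int) set" where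
  "rat_generators m V = {cycle_push g (principal_divisor n C e F G) | n C g e F G.
     smooth_projective_curve n C \<and> regular_map base_field n C m V g \<and> nonzero_function n C e F G}"

lemma rat_equiv_eq: "rat_equiv m V = generate (zero_cycles V) (rat_generators m V)"
  by (simp add: rat_equiv_def rat_generators_def)

lemma curve_closed: "smooth_projective_curve n C \<Longrightarrow> zariski_closed base_field n C"
  by (simp add: smooth_projective_curve_def irreducible_closed_def)

lemma rat_generators_keys: "rat_generators m V \<subseteq> {c. Poly_Mapping.keys c \<subseteq> closed_points V}"
  unfolding rat_generators_def
  using cycle_push_keys[OF curve_closed _ keys_principal_divisor] by blast

text \<open>A push-forward from a curve, pushed on along \<open>f\<close>, is the push-forward of
  the same principal divisor along the composite map.\<close>

lemma rat_generators_push: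
  assumes V: "zariski_closed base_field m V" and f: "regular_map base_field m V l W f"
    and a: "a \<in> rat_generators m V"
  shows "cycle_push f a \<in> rat_generators l W"
proof -
  obtain n C g e F G where a: "a = cycle_push g (principal_divisor n C e F G)"
    and C: "smooth_projective_curve n C" "regular_map base_field n C m V g" "nonzero_function n C e F G"
    using a unfolding rat_generators_def by blast
  have "cycle_push f a = cycle_push (\<lambda>P. f (g P)) (principal_divisor n C e F G)"
    unfolding a by (rule cycle_push_compose[OF curve_closed[OF C(1)] V C(2) f keys_principal_divisor])
  then show ?thesis
    unfolding rat_generators_def using C regular_map_compose[OF C(2) f] by blast
qed

lemma rat_equiv_push:
  assumes "zariski_closed base_field m V" "regular_map base_field m V l W f" "a \<in> rat_equiv m V"
  shows "cycle_push f a \<in> rat_equiv l W"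
  using assms(3) unfolding rat_equiv_eq cycle_push_def
  by (rule generate_frag_extend[OF rat_generators_keys rat_generators_keys, rotated])
    (use rat_generators_push[OF assms(1,2)] in \<open>auto simp: cycle_push_def intro: generate.incl\<close>)

text \<open>The degree of a principal divisor is zero, but this is not needed: composing with a constant
  map shows that rational equivalence on every variety with a rational point leads to the same
  set of degrees.\<close>

lemma cycle_degree_rat_equiv_subset:
  fixes V W :: "'k::field point set"
  assumes V: "V \<subseteq> proj_space m" and W: "W \<subseteq> proj_space l"
    and P: "P \<in> W" "range P \<subseteq> base_field"
  shows "cycle_degree ` rat_equiv m V \<subseteq> cycle_degree ` rat_equiv l W"
proof
  fix d assume "d \<in> cycle_degree ` rat_equiv m V"
  then obtain a where "a \<in> rat_equiv m V" "d = cycle_degree a" by blast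
  note add = generate_frag_add[OF rat_generators_keys]
    and uminus = generate_frag_uminus[OF rat_generators_keys]
  from \<open>a \<in> rat_equiv m V\<close> have "\<exists>b\<in>rat_equiv l W. cycle_degree b = cycle_degree a"
    unfolding rat_equiv_eq
  proof (induction rule: generate_frag_induct[OF rat_generators_keys, consumes 1])
    case 1
    show ?case by (rule bexI[of _ 0]) (simp_all add: generate_frag_0[OF rat_generators_keys])
  next
    case (2 a)
    then obtain n C g e F G where a: "a = cycle_push g (principal_divisor n C e F G)"
      and C: "smooth_projective_curve n C" "regular_map base_field n C m V g" "nonzero_function n C e F G"
      unfolding rat_generators_def by blast
    note D = keys_principal_divisor[of n C e F G]
    have const: "regular_map base_field n C l W (\<lambda>_. P)"
      using P W by (intro regular_map_const) auto
    have "cycle_push (\<lambda>_. P) (principal_divisor n C e F G) \<in> rat_generators l W"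
      unfolding rat_generators_def using C const by blast
    then show ?case
      using cycle_degree_push[OF curve_closed[OF C(1)] V C(2) D]
        cycle_degree_push[OF curve_closed[OF C(1)] W const D]
      by (intro bexI[of _ "cycle_push (\<lambda>_. P) (principal_divisor n C e F G)"])
        (auto simp: a intro: generate.incl)
  next
    case (3 a b)
    then obtain a' b' where "a' \<in> generate (zero_cycles W) (rat_generators l W)"
      "b' \<in> generate (zero_cycles W) (rat_generators l W)"
      "cycle_degree a' = cycle_degree a" "cycle_degree b' = cycle_degree b" by blast
    then show ?case by (intro bexI[of _ "a' + b'"] add) (auto simp: cycle_degree_add)
  next
    case (4 a)
    then obtain a' where "a' \<in> generate (zero_cycles W) (rat_generators l W)"
      "cycle_degree a' = cycle_degree a" by blast
    then show ?case by (intro bexI[of _ "- a'"] uminus) (auto simp: cycle_degree_uminus)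
  qed
  then show "d \<in> cycle_degree ` rat_equiv l W" using \<open>d = cycle_degree a\<close> by (metis imageI)
qed

section \<open>Relations between symbols\<close>

lemma symbols_replicate:
  "(L, as) \<in> symbols (replicate r A) \<longleftrightarrow>
    finite_ext L \<and> length as = r \<and> set as \<subseteq> rational_points A L"
  by (auto simp: symbols_def list_all2_conv_all_nth set_conv_nth)

lemma symbols_update:
  assumes "(L, as) \<in> symbols (replicate r A)" "a \<in> rational_points A L"
  shows "(L, as[i := a]) \<in> symbols (replicate r A)"
  using assms set_update_subset_insert[of as i a] by (auto simp: symbols_replicate)

lemma subfield_hom_id: "finite_ext L \<Longrightarrow> subfield_hom L (\<lambda>x. x)"
  using finite_extD k_hom_id by (intro subfield_hom.intro)

lemma rational_points_embedding:
  assumes "abelian_variety A" "finite_ext K" "\<tau> \<in> embeddings K L" "a \<in> rational_points A K"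
  shows "\<tau> \<circ> a \<in> rational_points A L"
proof -
  have "\<tau> ` K \<subseteq> L" using embeddings_iff[OF finite_extD(2,1)[OF assms(2)]] assms(3) by blast
  then show ?thesis
    using rational_points_hom[OF assms(1) subfield_hom_embedding[OF assms(2,3)] assms(4)]
    unfolding rational_points_def by blast
qed

lemma rational_points_regular_map:
  assumes "regular_map base_field n V (ambient A) (carrier A) g" "P \<in> V"
    "subfield L kbar" "base_field \<subseteq> L" "range P \<subseteq> L"
  shows "g P \<in> rational_points A L"
proof -
  have "g P \<in> carrier A" using assms(1,2) unfolding regular_map_def by blast
  then show ?thesis using range_regular_map[OF assms] by (simp add: rational_points_def)
qed

definition symmetric_generators ::
  "nat \<Rightarrow> 'k::field alg_closure proj_group \<Rightarrow> ('k symbol \<Rightarrow>\<^sub>0 int) set" where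
  "symmetric_generators r A = somekawa_relations (replicate r A) \<union> permutation_relations r A"

lemma symmetric_relations_eq:
  "symmetric_relations r A =
    generate (free_Abelian_group (symbols (replicate r A))) (symmetric_generators r A)"
  by (simp add: symmetric_relations_def symmetric_generators_def)

text \<open>Every \<open>replicate r A ! i\<close> is already replaced by \<open>A\<close>, so that
  the case analyses below see a single variety.\<close>

lemma symmetric_generators_cases [consumes 1, case_names multilinear projection weil permutation]:
  assumes "c \<in> symmetric_generators r A"
  obtains L as i a b where
    "c = frag_of (L, as[i := a \<otimes>\<^bsub>A\<^esub> b]) - frag_of (L, as[i := a]) - frag_of (L, as[i := b])"
    "(L, as) \<in> symbols (replicate r A)" "i < r" "a \<in> rational_points A L" "b \<in> rational_points A L"
  | K L \<tau> as i a where
    "c = frag_of (L, (map (\<lambda>b. \<tau> \<circ> b) as)[i := a]) - frag_of (K, as[i := norm_map A \<tau> K L a])"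
    "finite_ext K" "finite_ext L" "\<tau> \<in> embeddings K L" "(K, as) \<in> symbols (replicate r A)"
    "i < r" "a \<in> rational_points A L"
  | n C gs e F G where
    "c = frag_extend (\<lambda>x. frag_of (residue_field (geom_point x), map (\<lambda>g. g (geom_point x)) gs))
       (principal_divisor n C e F G)"
    "smooth_projective_curve n C" "nonzero_function n C e F G" "length gs = r"
    "\<And>g. g \<in> set gs \<Longrightarrow> regular_map base_field n C (ambient A) (carrier A) g"
  | L as p where
    "c = frag_of (L, permute_list p as) - frag_of (L, as)"
    "(L, as) \<in> symbols (replicate r A)" "p permutes {..<r}"
proof -
  consider (a) "c \<in> multilinear_relations (replicate r A)" | (b) "c \<in> projection_relations (replicate r A)"
    | (c) "c \<in> weil_relations (replicate r A)" | (d) "c \<in> permutation_relations r A"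
    using assms unfolding symmetric_generators_def somekawa_relations_def by blast
  then show ?thesis
  proof cases
    case a
    then obtain L as i a b where
      "c = frag_of (L, as[i := a \<otimes>\<^bsub>replicate r A ! i\<^esub> b]) - frag_of (L, as[i := a]) - frag_of (L, as[i := b])"
      "(L, as) \<in> symbols (replicate r A)" "i < r" "a \<in> rational_points (replicate r A ! i) L"
      "b \<in> rational_points (replicate r A ! i) L"
      unfolding multilinear_relations_def length_replicate by blast
    then show ?thesis using that(1)[of L as i a b] by simp
  next
    case b
    then obtain K L \<tau> as i a where
      "c = frag_of (L, (map (\<lambda>b. \<tau> \<circ> b) as)[i := a]) -
         frag_of (K, as[i := norm_map (replicate r A ! i) \<tau> K L a])"
      "finite_ext K" "finite_ext L" "\<tau> \<in> embeddings K L" "(K, as) \<in> symbols (replicate r A)"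
      "i < r" "a \<in> rational_points (replicate r A ! i) L"
      unfolding projection_relations_def length_replicate by blast
    then show ?thesis using that(2)[of L \<tau> as i a K] by simp
  next
    case c
    then obtain n C gs e F G where w:
      "c = frag_extend (\<lambda>x. frag_of (residue_field (geom_point x), map (\<lambda>g. g (geom_point x)) gs))
         (principal_divisor n C e F G)"
      "smooth_projective_curve n C" "nonzero_function n C e F G"
      and gs: "list_all2 (\<lambda>g A. regular_map base_field n C (ambient A) (carrier A) g) gs (replicate r A)"
      unfolding weil_relations_def by blast
    have "length gs = r" using list_all2_lengthD[OF gs] by simp
    moreover have "regular_map base_field n C (ambient A) (carrier A) g" if "g \<in> set gs" for g
      using gs that by (auto simp: list_all2_conv_all_nth in_set_conv_nth)
    ultimately show ?thesis by (rule that(3)[OF w])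
  next
    case d
    then show ?thesis unfolding permutation_relations_def using that(4) by blast
  qed
qed

lemma symmetric_generatorsI:
  fixes A :: "'k::field alg_closure proj_group"
  shows multilinear_generator:
    "(L, as) \<in> symbols (replicate r A) \<Longrightarrow> i < r \<Longrightarrow> a \<in> rational_points A L \<Longrightarrow>
      b \<in> rational_points A L \<Longrightarrow>
      frag_of (L, as[i := a \<otimes>\<^bsub>A\<^esub> b]) - frag_of (L, as[i := a]) - frag_of (L, as[i := b])
        \<in> symmetric_generators r A"
    and projection_generator:
    "finite_ext K \<Longrightarrow> finite_ext L \<Longrightarrow> \<tau> \<in> embeddings K L \<Longrightarrow> (K, as) \<in> symbols (replicate r A) \<Longrightarrow>
      i < r \<Longrightarrow> a' \<in> rational_points A L \<Longrightarrow>
      frag_of (L, (map (\<lambda>b. \<tau> \<circ> b) as)[i := a']) - frag_of (K, as[i := norm_map A \<tau> K L a'])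
        \<in> symmetric_generators r A"
    and weil_generator:
    "smooth_projective_curve n C \<Longrightarrow> nonzero_function n C e F G \<Longrightarrow> length gs = r \<Longrightarrow>
      (\<And>g. g \<in> set gs \<Longrightarrow> regular_map base_field n C (ambient A) (carrier A) g) \<Longrightarrow>
      frag_extend (\<lambda>x. frag_of (residue_field (geom_point x), map (\<lambda>g. g (geom_point x)) gs))
        (principal_divisor n C e F G) \<in> symmetric_generators r A"
    and permutation_generator:
    "(L, as) \<in> symbols (replicate r A) \<Longrightarrow> p permutes {..<r} \<Longrightarrow>
      frag_of (L, permute_list p as) - frag_of (L, as) \<in> symmetric_generators r A"
proof -
  assume *: "(L, as) \<in> symbols (replicate r A)" "i < r" "a \<in> rational_points A L"
    "b \<in> rational_points A L"
  have "frag_of (L, as[i := a \<otimes>\<^bsub>A\<^esub> b]) - frag_of (L, as[i := a]) - frag_of (L, as[i := b])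
      \<in> multilinear_relations (replicate r A)"
    unfolding multilinear_relations_def
    by (rule CollectI, rule exI[of _ L], rule exI[of _ as], rule exI[of _ i], rule exI[of _ a],
        rule exI[of _ b]) (use * in simp)
  then show "frag_of (L, as[i := a \<otimes>\<^bsub>A\<^esub> b]) - frag_of (L, as[i := a]) - frag_of (L, as[i := b])
      \<in> symmetric_generators r A"
    by (simp add: symmetric_generators_def somekawa_relations_def)
next
  assume *: "finite_ext K" "finite_ext L" "\<tau> \<in> embeddings K L" "(K, as) \<in> symbols (replicate r A)"
    "i < r" "a' \<in> rational_points A L"
  have "frag_of (L, (map (\<lambda>b. \<tau> \<circ> b) as)[i := a']) - frag_of (K, as[i := norm_map A \<tau> K L a'])
      \<in> projection_relations (replicate r A)"
    unfolding projection_relations_def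
    by (rule CollectI, rule exI[of _ K], rule exI[of _ L], rule exI[of _ \<tau>], rule exI[of _ as],
        rule exI[of _ i], rule exI[of _ a']) (use * in simp)
  then show "frag_of (L, (map (\<lambda>b. \<tau> \<circ> b) as)[i := a']) - frag_of (K, as[i := norm_map A \<tau> K L a'])
      \<in> symmetric_generators r A"
    by (simp add: symmetric_generators_def somekawa_relations_def)
next
  assume *: "smooth_projective_curve n C" "nonzero_function n C e F G" "length gs = r"
    "\<And>g. g \<in> set gs \<Longrightarrow> regular_map base_field n C (ambient A) (carrier A) g"
  then have "list_all2 (\<lambda>g A. regular_map base_field n C (ambient A) (carrier A) g) gs (replicate r A)"
    by (simp add: list_all2_conv_all_nth)
  then have "frag_extend (\<lambda>x. frag_of (residue_field (geom_point x), map (\<lambda>g. g (geom_point x)) gs))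
      (principal_divisor n C e F G) \<in> weil_relations (replicate r A)"
    unfolding weil_relations_def using *(1,2) by blast
  then show "frag_extend (\<lambda>x. frag_of (residue_field (geom_point x), map (\<lambda>g. g (geom_point x)) gs))
      (principal_divisor n C e F G) \<in> symmetric_generators r A"
    by (simp add: symmetric_generators_def somekawa_relations_def)
next
  assume "(L, as) \<in> symbols (replicate r A)" "p permutes {..<r}"
  then show "frag_of (L, permute_list p as) - frag_of (L, as) \<in> symmetric_generators r A"
    unfolding symmetric_generators_def permutation_relations_def by blast
qed

lemma keys_frag_of_diff: "Poly_Mapping.keys (frag_of a - frag_of b) \<subseteq> {a, b}"
  using keys_diff[of "frag_of a" "frag_of b"] by auto

text \<open>This makes the generated relations a subgroup. The projection case rests on
  \<open>norm_map_rational\<close>, the Weil case on regular maps over k sending a point to one that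
  is rational over its residue field.\<close>

lemma symmetric_generators_keys:
  fixes A :: "'k::field alg_closure proj_group"
  assumes perfect: "perfect_field TYPE('k)" and A: "abelian_variety A"
  shows "symmetric_generators r A \<subseteq> {c. Poly_Mapping.keys c \<subseteq> symbols (replicate r A)}"
proof
  fix c assume "c \<in> symmetric_generators r A"
  then have "Poly_Mapping.keys c \<subseteq> symbols (replicate r A)"
  proof (cases rule: symmetric_generators_cases)
    case (multilinear L as i a b)
    have "a \<otimes>\<^bsub>A\<^esub> b \<in> rational_points A L"
      using multilinear(2,4,5)
      by (intro rational_points_mult(1)[OF A subfield_hom_id]) (auto simp: symbols_replicate)
    then have "(L, as[i := x]) \<in> symbols (replicate r A)" if "x \<in> {a \<otimes>\<^bsub>A\<^esub> b, a, b}" for x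
      using symbols_update[OF multilinear(2)] multilinear(4,5) that by blast
    then show ?thesis
      unfolding multilinear(1)
      by (intro order_trans[OF keys_diff] Un_least order_trans[OF keys_frag_of_diff]) auto
  next
    case (projection K L \<tau> as i a)
    have "(L, map (\<lambda>b. \<tau> \<circ> b) as) \<in> symbols (replicate r A)"
      using projection(3,5) rational_points_embedding[OF A projection(2,4)]
      by (auto simp: symbols_replicate simp del: comp_apply)
    then show ?thesis
      unfolding projection(1)
      using symbols_update projection(5,7)
        norm_map_rational[OF perfect A projection(2,3,4,7)]
      by (intro order_trans[OF keys_frag_of_diff]) blast
  next
    case (weil n C gs e F G)
    have "(residue_field (geom_point x), map (\<lambda>g. g (geom_point x)) gs) \<in> symbols (replicate r A)"
      if x: "x \<in> closed_points C" for x
    proof -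
      have C: "zariski_closed base_field n C" by (rule curve_closed[OF weil(2)])
      note P = geom_point_closed_point(1)[OF C x]
      have "finite_ext (residue_field (geom_point x))"
        using zariski_closed_proj_space[OF C] P by (auto intro: finite_ext_residue_field)
      then show ?thesis
        using weil(4) rational_points_regular_map[OF weil(5) P subfield_residue_field
            base_residue_field range_residue_field]
        by (auto simp: symbols_replicate)
    qed
    then show ?thesis
      unfolding weil(1) using keys_principal_divisor[of n C e F G]
      by (intro order_trans[OF keys_frag_extend]) auto
  next
    case (permutation L as p)
    then have "(L, permute_list p as) \<in> symbols (replicate r A)"
      by (simp add: symbols_replicate)
    then show ?thesis
      unfolding permutation(1) using permutation(2)
      by (intro order_trans[OF keys_frag_of_diff]) auto
  qed
  then show "c \<in> {c. Poly_Mapping.keys c \<subseteq> symbols (replicate r A)}" by simp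
qed

abbreviation symbol_push :: "('k::field point \<Rightarrow> 'k point) \<Rightarrow> ('k symbol \<Rightarrow>\<^sub>0 int) \<Rightarrow> ('k symbol \<Rightarrow>\<^sub>0 int)" where
  "symbol_push \<phi> \<equiv> frag_extend (frag_of \<circ> apsnd (map \<phi>))"

text \<open>Each kind of generator goes to the same kind: \<open>\<phi>\<close> respects the group
  laws, commutes with embeddings and norms, can be composed with the maps of a Weil relation, and
  acts on entries whereas permutations act on positions. So \<open>symbol_push\<close> descends to
  the symmetric K-groups.\<close>

lemma symmetric_generators_push:
  assumes A: "abelian_variety A" and B: "abelian_variety B"
    and \<phi>: "regular_map base_field (ambient A) (carrier A) (ambient B) (carrier B) \<phi>"
      "\<phi> \<in> hom A B"
    and c: "c \<in> symmetric_generators r A"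
  shows "symbol_push \<phi> c \<in> symmetric_generators r B"
proof -
  have rat: "\<phi> a \<in> rational_points B L" if "finite_ext L" "a \<in> rational_points A L" for a L
    using that(2) finite_extD[OF that(1)]
    by (intro rational_points_regular_map[OF \<phi>(1)]) (auto simp: rational_points_def)
  have symb: "(L, map \<phi> as) \<in> symbols (replicate r B)"
    if "(L, as) \<in> symbols (replicate r A)" for L as
    using that rat by (auto simp: symbols_replicate)
  from c show ?thesis
  proof (cases rule: symmetric_generators_cases)
    case (multilinear L as i a b)
    have L: "finite_ext L" using multilinear(2) by (simp add: symbols_replicate)
    have "\<phi> (a \<otimes>\<^bsub>A\<^esub> b) = \<phi> a \<otimes>\<^bsub>B\<^esub> \<phi> b"
      using hom_mult[OF \<phi>(2)] multilinear(4,5) by (simp add: rational_points_def)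
    then show ?thesis
      using multilinear_generator[OF symb[OF multilinear(2)] multilinear(3) rat[OF L multilinear(4)]
          rat[OF L multilinear(5)]]
      by (simp add: multilinear(1) frag_extend_diff map_update)
  next
    case (projection K L \<tau> as i a)
    note \<tau> = subfield_hom_embedding[OF projection(2,4)]
    have "\<phi> (\<tau> \<circ> b) = \<tau> \<circ> \<phi> b" if b: "b \<in> set as" for b
    proof -
      have b: "b \<in> rational_points A K" using b projection(5) by (auto simp: symbols_replicate)
      show ?thesis
        using b by (intro regular_map_hom(2)[OF \<tau> \<phi>(1) _ rational_points_hom(1)[OF A \<tau> b]])
          (auto simp: rational_points_def)
    qed
    then have "map \<phi> (map (\<lambda>b. \<tau> \<circ> b) as) = map (\<lambda>b. \<tau> \<circ> b) (map \<phi> as)" by simp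
    then have "symbol_push \<phi> c = frag_of (L, (map (\<lambda>b. \<tau> \<circ> b) (map \<phi> as))[i := \<phi> a]) -
        frag_of (K, (map \<phi> as)[i := norm_map B \<tau> K L (\<phi> a)])"
      by (simp only: projection(1) frag_extend_diff frag_extend_of comp_apply apsnd_conv map_update
          norm_map_hom[OF A B \<phi> projection(3,7)])
    then show ?thesis
      using projection_generator[OF projection(2-4) symb[OF projection(5)] projection(6)
          rat[OF projection(3,7)]] by (simp only:)
  next
    case (weil n C gs e F G)
    \<comment> \<open>The inner map is brought into the shape of \<open>frag_of\<close> after a
      function, as \<open>frag_extend_compose\<close> requires.\<close>
    have eq: "(\<lambda>x. frag_of (residue_field (geom_point x), map (\<lambda>g. g (geom_point x)) gs)) =
        frag_of \<circ> (\<lambda>x. (residue_field (geom_point x), map (\<lambda>g. g (geom_point x)) gs))"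
      by (simp add: fun_eq_iff)
    have "symbol_push \<phi> c = frag_extend
        (\<lambda>x. frag_of (residue_field (geom_point x), map (\<lambda>g. g (geom_point x)) (map (\<lambda>g P. \<phi> (g P)) gs)))
        (principal_divisor n C e F G)"
      unfolding weil(1) eq frag_extend_compose
      by (rule frag_extend_eq) (simp add: comp_def)
    moreover have "\<dots> \<in> symmetric_generators r B"
      using weil(4,5) regular_map_compose[OF _ \<phi>(1)]
      by (intro weil_generator[OF weil(2,3)]) auto
    ultimately show ?thesis by simp
  next
    case (permutation L as p)
    have "map \<phi> (permute_list p as) = permute_list p (map \<phi> as)"
      using permutation(2,3) by (simp add: permute_list_map symbols_replicate)
    then show ?thesis
      using permutation_generator[OF symb[OF permutation(2)] permutation(3)]
      by (simp add: permutation(1) frag_extend_diff)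
  qed
qed

section \<open>Compatibility of the maps to the symmetric K-groups\<close>

text \<open>\<open>Phi\<close> on the level of cycles, before cosets are taken.\<close>

definition symbol_cycle :: "nat \<Rightarrow> ('k::field point set \<Rightarrow>\<^sub>0 int) \<Rightarrow> ('k symbol \<Rightarrow>\<^sub>0 int)" where
  "symbol_cycle r = frag_extend (\<lambda>x. frag_of (residue_field (geom_point x), replicate r (geom_point x)))"

context
  fixes A :: "'k::field alg_closure proj_group"
  assumes perfect: "perfect_field TYPE('k)" and A: "abelian_variety A"
begin

interpretation comm_group A by (rule abelian_variety_comm_group[OF A])

lemmas relations_add = generate_frag_add[OF symmetric_generators_keys[OF perfect A],
    folded symmetric_relations_eq]
  and relations_0 = generate_frag_0[OF symmetric_generators_keys[OF perfect A],
    folded symmetric_relations_eq]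
  and relations_uminus = generate_frag_uminus[OF symmetric_generators_keys[OF perfect A],
    folded symmetric_relations_eq]
  and relations_diff = generate_frag_diff[OF symmetric_generators_keys[OF perfect A],
    folded symmetric_relations_eq]
  and relations_coset_eq = generate_frag_coset_eq[OF symmetric_generators_keys[OF perfect A],
    folded symmetric_relations_eq]
  and relations_coset_cong = generate_frag_coset_cong[OF symmetric_generators_keys[OF perfect A],
    folded symmetric_relations_eq]

lemma relations_generator: "c \<in> symmetric_generators r A \<Longrightarrow> c \<in> symmetric_relations r A"
  unfolding symmetric_relations_eq by (rule generate.incl)

text \<open>Multilinearity in one entry, iterated; as the group law is written multiplicatively,
  powers turn into multiples.\<close>

lemma symbol_pow:
  assumes as: "(L, as) \<in> symbols (replicate r A)" and i: "i < r" and a: "a \<in> rational_points A L"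
  shows "frag_of (L, as[i := a [^]\<^bsub>A\<^esub> n]) - frag_cmul (int n) (frag_of (L, as[i := a])) \<in> symmetric_relations r A"
proof (induction n)
  have L: "subfield_hom L (\<lambda>x. x)" using as subfield_hom_id[of L] by (simp add: symbols_replicate)
  case 0
  have one: "\<one>\<^bsub>A\<^esub> \<in> rational_points A L" by (rule rational_points_one[OF A subfield_hom.base[OF L]])
  \<comment> \<open>The multilinearity relation for the product of the unit with itself cancels down
    to minus this symbol.\<close>
  have "- frag_of (L, as[i := \<one>\<^bsub>A\<^esub>]) \<in> symmetric_relations r A"
    using relations_generator[OF multilinear_generator[OF as i one one]] by simp
  then show ?case using relations_uminus by force
next
  have L: "subfield_hom L (\<lambda>x. x)" using as subfield_hom_id[of L] by (simp add: symbols_replicate)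
  case (Suc n)
  from relations_add[OF relations_generator[OF multilinear_generator[OF as i
        rational_points_pow[OF A L a, of n] a]] Suc]
  show ?case by (simp add: frag_cmul_distrib algebra_simps)
qed

text \<open>The projection formula moves the norm to a single entry, all others being restrictions
  already; positivity of \<open>r\<close> provides that entry.\<close>

lemma symbol_restrict:
  assumes K: "finite_ext K" and L: "finite_ext L" and \<tau>: "\<tau> \<in> embeddings K L"
    and a: "a \<in> rational_points A K" and r: "r > 0"
  shows "frag_of (L, replicate r (\<tau> \<circ> a)) -
    frag_cmul (int (ext_degree (\<tau> ` K) L)) (frag_of (K, replicate r a)) \<in> symmetric_relations r A"
proof -
  have as: "(K, replicate r a) \<in> symbols (replicate r A)"
    using K a by (auto simp: symbols_replicate)
  \<comment> \<open>A constant list is an update of itself at entry 0, which is the shape of the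
    projection and multilinearity relations.\<close>
  have upd: "(replicate r x)[0 := x] = replicate r x" for x :: "'k point"
    using r by (cases r) auto
  have "frag_of (L, replicate r (\<tau> \<circ> a)) -
      frag_of (K, (replicate r a)[0 := a [^]\<^bsub>A\<^esub> ext_degree (\<tau> ` K) L]) \<in> symmetric_relations r A"
    using relations_generator[OF projection_generator[OF K L \<tau> as r rational_points_embedding[OF A K \<tau> a]]]
    by (simp only: map_replicate upd norm_map_restrict[OF perfect A K L \<tau> a])
  from relations_add[OF this symbol_pow[OF as r a, of "ext_degree (\<tau> ` K) L"]] show ?thesis by (simp only: upd add_diff_eq diff_add_cancel)
qed

text \<open>On one closed point this is \<open>symbol_restrict\<close> with the degree of k(P) over
  k(g P). The representative Q of the image is only a conjugate of \<open>g P\<close>, so k(Q) need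
  not lie in k(P); the projection relations along arbitrary embeddings absorb the
  difference.\<close>

lemma symbol_cycle_push:
  assumes V: "zariski_closed base_field n V"
    and g: "regular_map base_field n V (ambient A) (carrier A) g" and r: "r > 0"
    and z: "Poly_Mapping.keys z \<subseteq> closed_points V"
  shows "symbol_cycle r (cycle_push g z) -
    frag_extend (\<lambda>x. frag_of (residue_field (geom_point x), replicate r (g (geom_point x)))) z
      \<in> symmetric_relations r A"
  using z
proof (induction z rule: frag_induction)
  case zero
  show ?case by (simp add: symbol_cycle_def cycle_push_def relations_0)
next
  case (diff a b)
  from relations_diff[OF diff] show ?case
    by (simp add: symbol_cycle_def cycle_push_def frag_extend_diff algebra_simps)
next
  case (one x)
  define P where "P = geom_point x"
  have P: "P \<in> V" unfolding P_def by (rule geom_point_closed_point(1)[OF V one])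
  have gP: "g P \<in> carrier A" using g P unfolding regular_map_def by blast
  obtain \<sigma> where \<sigma>: "\<sigma> \<in> galois_group" "geom_point (g ` x) = \<sigma> \<circ> g P"
    using geom_point_image[OF V g one] unfolding P_def .
  define Q where "Q = \<sigma> \<circ> g P"
  have Q: "Q \<in> carrier A"
    unfolding Q_def
    by (rule hom_zariski_closed[OF subfield_hom_galois[OF \<sigma>(1)] abelian_variety_closed[OF A] gP]) simp
  define K where "K = residue_field Q"
  \<comment> \<open>\<open>\<sigma>\<close> carries \<open>g P\<close> to \<open>Q\<close>, so its
    inverse carries k(Q) onto k(g P), which lies in k(P). The restriction to \<open>K\<close>
    supplies the extensionality demanded by \<open>embeddings\<close>.\<close>
  define \<tau> where "\<tau> = restrict (inv_into UNIV \<sigma>) K"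
  have K: "finite_ext K"
    unfolding K_def by (rule finite_ext_residue_field[OF abelian_variety_proj_space[OF A Q]])
  have L: "finite_ext (residue_field P)"
    using zariski_closed_proj_space[OF V] P by (auto intro: finite_ext_residue_field)
  have inv: "inv_into UNIV \<sigma> \<in> galois_group" by (rule galois_inv[OF \<sigma>(1)])
  have "inv_into UNIV \<sigma> \<circ> Q = g P"
    using \<sigma>(1) by (simp add: Q_def galois_group_iff bij_is_inj comp_assoc[symmetric])
  then have image: "\<tau> ` K = residue_field (g P)"
    using image_residue_field_galois[OF inv, of Q] by (simp add: \<tau>_def K_def)
  have Qi: "Q i \<in> K" for i using range_residue_field[of Q] by (auto simp: K_def)
  then have \<tau>Q: "\<tau> \<circ> Q = g P"
    using \<open>inv_into UNIV \<sigma> \<circ> Q = g P\<close> by (auto simp: \<tau>_def fun_eq_iff)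
  have "k_hom K (inv_into UNIV \<sigma>)"
    using inv k_hom_subset by (auto simp: galois_group_iff)
  then have "k_hom K \<tau>"
    using k_hom_cong[OF finite_extD(2,1)[OF K], of \<tau> "inv_into UNIV \<sigma>"] by (simp add: \<tau>_def)
  moreover have "\<tau> ` K \<subseteq> residue_field P" unfolding image by (rule residue_field_regular_map[OF g P])
  ultimately have \<tau>: "\<tau> \<in> embeddings K (residue_field P)"
    using embeddings_iff[OF finite_extD(2,1)[OF K]] by (simp add: \<tau>_def)
  have "Q \<in> rational_points A K" using Q Qi by (auto simp: rational_points_def)
  from relations_uminus[OF symbol_restrict[OF K L \<tau> this r]] show ?case
    using \<sigma>(2) by (simp only: \<tau>Q image)
      (simp add: symbol_cycle_def cycle_push_def frag_extend_cmul flip: P_def Q_def K_def)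
qed

lemma symbol_cycle_rat_equiv:
  assumes r: "r > 0" and z: "z \<in> rat_equiv (ambient A) (carrier A)"
  shows "symbol_cycle r z \<in> symmetric_relations r A"
proof -
  have "symbol_cycle r c \<in> symmetric_relations r A"
    if c: "c \<in> rat_generators (ambient A) (carrier A)" for c
  proof -
    obtain n C g e F G where c: "c = cycle_push g (principal_divisor n C e F G)"
      and C: "smooth_projective_curve n C" "regular_map base_field n C (ambient A) (carrier A) g"
        "nonzero_function n C e F G"
      using c unfolding rat_generators_def by blast
    \<comment> \<open>Weil reciprocity for \<open>r\<close> copies of the same map.\<close>
    have "frag_extend (\<lambda>x. frag_of (residue_field (geom_point x), replicate r (g (geom_point x))))
        (principal_divisor n C e F G) \<in> symmetric_relations r A"
      using relations_generator[OF weil_generator[OF C(1,3), of "replicate r g" r A]] C(2) by simp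
    from relations_add[OF symbol_cycle_push[OF curve_closed[OF C(1)] C(2) r keys_principal_divisor[of n C e F G]] this]
    show ?thesis by (simp add: c)
  qed
  then show ?thesis
    unfolding symbol_cycle_def symmetric_relations_eq
    by (rule generate_frag_extend[OF rat_generators_keys symmetric_generators_keys[OF perfect A]
          _ z[unfolded rat_equiv_eq]])
qed

lemma symbol_cycle_keys:
  assumes z: "Poly_Mapping.keys z \<subseteq> closed_points (carrier A)"
  shows "Poly_Mapping.keys (symbol_cycle r z) \<subseteq> symbols (replicate r A)"
proof -
  have "(residue_field (geom_point x), replicate r (geom_point x)) \<in> symbols (replicate r A)"
    if x: "x \<in> closed_points (carrier A)" for x
  proof -
    note P = geom_point_closed_point(1)[OF abelian_variety_closed[OF A] x]
    show ?thesis
      using finite_ext_residue_field[OF abelian_variety_proj_space[OF A P]] P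
        range_residue_field[of "geom_point x"]
      by (auto simp: symbols_replicate rational_points_def)
  qed
  then show ?thesis
    using z unfolding symbol_cycle_def by (intro order_trans[OF keys_frag_extend]) auto
qed

lemma CH_carrierE:
  assumes "c \<in> carrier (CH A)"
  obtains z where "Poly_Mapping.keys z \<subseteq> closed_points (carrier A)"
    "c = rat_equiv (ambient A) (carrier A) #>\<^bsub>zero_cycles (carrier A)\<^esub> z"
  using assms by (auto simp: CH0_def carrier_FactGroup)

lemma Phi_coset:
  assumes r: "r > 0" and z: "Poly_Mapping.keys z \<subseteq> closed_points (carrier A)"
  shows "Phi r A (rat_equiv (ambient A) (carrier A) #>\<^bsub>zero_cycles (carrier A)\<^esub> z) =
    symmetric_relations r A #>\<^bsub>free_Abelian_group (symbols (replicate r A))\<^esub> symbol_cycle r z"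
  unfolding Phi_def symbol_cycle_def[symmetric]
proof (rule the_elem_coset_image)
  fix h assume h: "h \<in> rat_equiv (ambient A) (carrier A)"
  have "symbol_cycle r (h + z) = symbol_cycle r h + symbol_cycle r z"
    by (simp add: symbol_cycle_def frag_extend_add)
  then show "symmetric_relations r A #>\<^bsub>free_Abelian_group (symbols (replicate r A))\<^esub> symbol_cycle r (h + z) =
      symmetric_relations r A #>\<^bsub>free_Abelian_group (symbols (replicate r A))\<^esub> symbol_cycle r z"
    using relations_coset_cong[OF symbol_cycle_keys[OF z] symbol_cycle_rat_equiv[OF r h]] by simp
next
  show "rat_equiv (ambient A) (carrier A) \<noteq> {}"
    unfolding rat_equiv_eq using generate_frag_0[OF rat_generators_keys] by blast
qed

text \<open>Replaces the condition on cosets by membership in a subgroup of relations, which can be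
  transported generator by generator.\<close>

lemma ker_Phi_iff:
  assumes r: "r > 0" and z: "Poly_Mapping.keys z \<subseteq> closed_points (carrier A)"
  shows "rat_equiv (ambient A) (carrier A) #>\<^bsub>zero_cycles (carrier A)\<^esub> z \<in> ker_Phi r A \<longleftrightarrow>
    symbol_cycle r z \<in> symmetric_relations r A"
proof -
  have "rat_equiv (ambient A) (carrier A) #>\<^bsub>zero_cycles (carrier A)\<^esub> z \<in> carrier (CH A)"
    using z by (auto simp: CH0_def carrier_FactGroup)
  then show ?thesis
    using r relations_coset_eq[OF symbol_cycle_keys[OF z]]
    by (simp add: ker_Phi_def kernel_def Phi_coset[OF r z] symmetric_K_def)
qed

end

text \<open>Applying \<open>\<phi>\<close> to the entries preserves relations but keeps the field
  k(x) where the push-forward of cycles passes to the residue field of the image point;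
  \<open>symbol_cycle_push\<close> bridges exactly this discrepancy.\<close>

lemma symbol_cycle_push_relations:
  fixes A B :: "'k::field alg_closure proj_group"
  assumes perfect: "perfect_field TYPE('k)" and A: "abelian_variety A" and B: "abelian_variety B"
    and \<phi>: "regular_map base_field (ambient A) (carrier A) (ambient B) (carrier B) \<phi>"
      "\<phi> \<in> hom A B"
    and r: "r > 0" and z: "Poly_Mapping.keys z \<subseteq> closed_points (carrier A)"
    and mem: "symbol_cycle r z \<in> symmetric_relations r A"
  shows "symbol_cycle r (cycle_push \<phi> z) \<in> symmetric_relations r B"
proof -
  have "symbol_push \<phi> (symbol_cycle r z) \<in> symmetric_relations r B"
    unfolding symmetric_relations_eq
    by (rule generate_frag_extend[OF symmetric_generators_keys[OF perfect A]
          symmetric_generators_keys[OF perfect B] _ mem[unfolded symmetric_relations_eq]],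
        rule generate.incl, rule symmetric_generators_push[OF A B \<phi>])
  moreover have "symbol_push \<phi> (symbol_cycle r z) =
      frag_extend (\<lambda>x. frag_of (residue_field (geom_point x), replicate r (\<phi> (geom_point x)))) z"
  proof -
    have "symbol_cycle r z = frag_extend
        (frag_of \<circ> (\<lambda>x. (residue_field (geom_point x), replicate r (geom_point x)))) z"
      by (simp add: symbol_cycle_def comp_def)
    then have "symbol_push \<phi> (symbol_cycle r z) = frag_extend ((frag_of \<circ> apsnd (map \<phi>)) \<circ>
        (\<lambda>x. (residue_field (geom_point x), replicate r (geom_point x)))) z"
      by (simp only: frag_extend_compose)
    also have "\<dots> = frag_extend
        (\<lambda>x. frag_of (residue_field (geom_point x), replicate r (\<phi> (geom_point x)))) z"
      by (rule frag_extend_eq) simp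
    finally show ?thesis .
  qed
  ultimately show ?thesis
    using relations_add[OF perfect B symbol_cycle_push[OF perfect B abelian_variety_closed[OF A] \<phi>(1) r z]]
    by fastforce
qed

section \<open>Passage to Chow groups\<close>

lemma CH0_push_coset:
  assumes V: "zariski_closed base_field m V" and f: "regular_map base_field m V l W f"
    and z: "Poly_Mapping.keys z \<subseteq> closed_points V"
  shows "CH0_push l W f (rat_equiv m V #>\<^bsub>zero_cycles V\<^esub> z) =
    rat_equiv l W #>\<^bsub>zero_cycles W\<^esub> cycle_push f z"
  unfolding CH0_push_def
proof (rule the_elem_coset_image)
  fix h assume h: "h \<in> rat_equiv m V"
  have "cycle_push f (h + z) = cycle_push f h + cycle_push f z"
    by (simp add: cycle_push_def frag_extend_add)
  then show "rat_equiv l W #>\<^bsub>zero_cycles W\<^esub> cycle_push f (h + z) =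
      rat_equiv l W #>\<^bsub>zero_cycles W\<^esub> cycle_push f z"
    using generate_frag_coset_cong[OF rat_generators_keys cycle_push_keys[OF V f z],
        folded rat_equiv_eq, OF rat_equiv_push[OF V f h]] by simp
next
  show "rat_equiv m V \<noteq> {}"
    unfolding rat_equiv_eq using generate_frag_0[OF rat_generators_keys] by blast
qed

lemma cycle_degree_coset:
  "cycle_degree ` (H #>\<^bsub>zero_cycles V\<^esub> z) = (\<lambda>d. d + cycle_degree z) ` (cycle_degree ` H)"
  by (auto simp: r_coset_def cycle_degree_add image_iff)

text \<open>The two cosets have the same set of degrees: rationally trivial cycles on A and B
  realise the same degrees, each variety having its unit as a rational point, and \<open>z\<close>
  has the degree of its push-forward. Equal sets give equal values of
  \<open>the_elem\<close>.\<close>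

lemma Phi0_push:
  assumes A: "abelian_variety A" and B: "abelian_variety B"
    and \<phi>: "regular_map base_field (ambient A) (carrier A) (ambient B) (carrier B) \<phi>"
    and z: "Poly_Mapping.keys z \<subseteq> closed_points (carrier A)"
  shows "Phi0 (rat_equiv (ambient B) (carrier B) #>\<^bsub>zero_cycles (carrier B)\<^esub> cycle_push \<phi> z) =
    Phi0 (rat_equiv (ambient A) (carrier A) #>\<^bsub>zero_cycles (carrier A)\<^esub> z)"
proof -
  have sub: "cycle_degree ` rat_equiv (ambient X') (carrier X') \<subseteq> cycle_degree ` rat_equiv (ambient Y) (carrier Y)"
    if "abelian_variety X'" "abelian_variety Y" for X' Y :: "'a alg_closure proj_group"
  proof -
    interpret Y: comm_group Y by (rule abelian_variety_comm_group[OF that(2)])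
    show ?thesis
      using cycle_degree_rat_equiv_subset[of "carrier X'" "ambient X'" "carrier Y" "ambient Y" "\<one>\<^bsub>Y\<^esub>"]
        zariski_closed_proj_space[OF abelian_variety_closed] range_one_subset_base that by blast
  qed
  have "cycle_degree ` rat_equiv (ambient A) (carrier A) = cycle_degree ` rat_equiv (ambient B) (carrier B)"
    using sub A B by (intro equalityI)
  moreover have "cycle_degree (cycle_push \<phi> z) = cycle_degree z"
    by (rule cycle_degree_push[OF abelian_variety_closed[OF A]
          zariski_closed_proj_space[OF abelian_variety_closed[OF B]] \<phi> z])
  ultimately show ?thesis by (simp add: Phi0_def cycle_degree_coset)
qed

theorem proposition1p1:
  fixes A B :: "'k::field alg_closure proj_group"
    and \<phi> :: "'k point \<Rightarrow> 'k point"
  assumes "perfect_field TYPE('k)"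
    and "abelian_variety A" and "abelian_variety B"
    and "isogeny A B \<phi>"
  shows "\<forall>r. CH0_push (ambient B) (carrier B) \<phi> ` filtration r A \<subseteq> filtration r B"
proof (intro allI subsetI)
  note perfect = assms(1) and A = assms(2) and B = assms(3)
  have \<phi>: "regular_map base_field (ambient A) (carrier A) (ambient B) (carrier B) \<phi>" "\<phi> \<in> hom A B"
    using assms(4) by (auto simp: isogeny_def)
  fix r c' assume "c' \<in> CH0_push (ambient B) (carrier B) \<phi> ` filtration r A"
  then obtain c where c: "c \<in> filtration r A" "c' = CH0_push (ambient B) (carrier B) \<phi> c" by blast
  then have cA: "c \<in> carrier (CH A)" and ker: "\<And>j. j < r \<Longrightarrow> c \<in> ker_Phi j A"
    by (auto simp: filtration_def)
  obtain z where z: "Poly_Mapping.keys z \<subseteq> closed_points (carrier A)"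
    "c = rat_equiv (ambient A) (carrier A) #>\<^bsub>zero_cycles (carrier A)\<^esub> z"
    using CH_carrierE[OF perfect A cA] .
  have c': "c' = rat_equiv (ambient B) (carrier B) #>\<^bsub>zero_cycles (carrier B)\<^esub> cycle_push \<phi> z"
    unfolding c(2) z(2) by (rule CH0_push_coset[OF abelian_variety_closed[OF A] \<phi>(1) z(1)])
  have keys: "Poly_Mapping.keys (cycle_push \<phi> z) \<subseteq> closed_points (carrier B)"
    by (rule cycle_push_keys[OF abelian_variety_closed[OF A] \<phi>(1) z(1)])
  then have cB: "c' \<in> carrier (CH B)"
    unfolding c' by (auto simp: CH0_def carrier_FactGroup)
  \<comment> \<open>At 0 the map is the degree instead of a map to symbols, and the symbol argument
    uses a first entry; hence the case distinction.\<close>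
  have "c' \<in> ker_Phi j B" if j: "j < r" for j
  proof (cases "j = 0")
    case True
    then show ?thesis
      using ker[OF j] cB Phi0_push[OF A B \<phi>(1) z(1)]
      by (simp add: ker_Phi_def kernel_def c' z(2))
  next
    case False
    then have "j > 0" by simp
    then show ?thesis
      using ker[OF j] ker_Phi_iff[OF perfect A _ z(1)] ker_Phi_iff[OF perfect B _ keys]
        symbol_cycle_push_relations[OF perfect A B \<phi> _ z(1)]
      unfolding c' z(2) by blast
  qed
  then show "c' \<in> filtration r B" using cB by (simp add: filtration_def)
qed

end
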